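(* Let $\mathcal{A}$ be an arrangement of linear hyperplanes in $\mathbb{R}^d$ and let $x\in\mathbb{R}^d$. Then $V_k(\mathcal{A})(x)>w_k(\mathcal{A})$ for some $0\le k\le d$ if and only if $x$ is contained in (a hyperplane of) the arrangement \[ \Pi(\mathcal{A}) \ = \ \bigcup_{L\in\mathcal{L}(\mathcal{A})} \big( (\mathcal{A}/L) + L^\perp \big) \, . \]
   Context: For $S\subseteq\mathbb{R}^d$, $[S]:\mathbb{R}^d\to\{0,1\}$ is the indicator function of $S$. For a polyhedral cone $C\subseteq\mathbb{R}^d$ (containing the origin), $\mathcal{F}_k(C)$ is the set of $k$-dimensional nonempty faces of $C$ (including $C$ itself if $k=\dim C$). For a nonempty face $F$ of $C$, $N_FC=\{c\in\mathbb{R}^d : \langle c,x\rangle\le\langle c,y\rangle \text{ for all } x\in C,\ y\in F\}$, and $\Pi_F(C)=F+N_FC$. Define the function $V_k(C)=\sum_{F\in\mathcal{F}_k(C)}[\Pi_F(C)]:\mathbb{R}^d\to\mathbb{Z}$. For an arrangement $\mathcal{A}$ of linear hyperplanes in $\mathbb{R}^d$ (finite collection), $\mathcal{N}(\mathcal{A})$ is the set of closures of the connected components of $\mathbb{R}^d\setminus\bigcup\mathcal{A}$, and $V_k(\mathcal{A})=\sum_{C\in\mathcal{N}(\mathcal{A})}V_k(C)$ (an actual function on $\mathbb{R}^d$, evaluated pointwise). The lattice of flats $\mathcal{L}(\mathcal{A})$ is the collection of all intersections of hyperplanes in $\mathcal{A}$ (including $\mathbb{R}^d$), ordered by reverse inclusion,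 with Möbius function $\mu$. The (unsigned) Whitney number of the first kind is $w_k=w_k(\mathcal{A})=\sum_{L\in\mathcal{L}(\mathcal{A}),\,\dim L=k}|\mu(\mathbb{R}^d,L)|$. For a flat $L$, the restriction $\mathcal{A}/L=\{H\cap L : H\in\mathcal{A},\ L\not\subseteq H\}$ is an arrangement of hyperplanes in $L$. For an arrangement $\mathcal{A}'$ of hyperplanes in a linear subspace $U\subseteq\mathbb{R}^d$, $\mathcal{A}'+U^\perp=\{H+U^\perp : H\in\mathcal{A}'\}$ is the corresponding arrangement of hyperplanes in $\mathbb{R}^d$. *)

theory Defs
  imports "HOL-Analysis.Analysis"
begin

definition linear_hyperplane :: "'a::euclidean_space set \<Rightarrow> bool" where
  "linear_hyperplane H \<longleftrightarrow> (\<exists>a. a \<noteq> 0 \<and> H = {x. a \<bullet> x = 0})"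

definition arrangement :: "'a::euclidean_space set set \<Rightarrow> bool" where
  "arrangement A \<longleftrightarrow> finite A \<and> (\<forall>H\<in>A. linear_hyperplane H)"

definition faces_of_dim :: "nat \<Rightarrow> 'a::euclidean_space set \<Rightarrow> 'a set set" where
  "faces_of_dim k C = {F. F face_of C \<and> F \<noteq> {} \<and> aff_dim F = int k}"

definition normal_cone :: "'a::euclidean_space set \<Rightarrow> 'a set \<Rightarrow> 'a set" where
  "normal_cone F C = {c. \<forall>x\<in>C. \<forall>y\<in>F. c \<bullet> x \<le> c \<bullet> y}"

text \<open>The sum of sets below is the Minkowski sum.\<close>

definition face_normal_sum :: "'a::euclidean_space set \<Rightarrow> 'a set \<Rightarrow> 'a set" where
  "face_normal_sum F C = F + normal_cone F C"

definition V_cone :: "nat \<Rightarrow> 'a::euclidean_space set \<Rightarrow> 'a \<Rightarrow> int" where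
  "V_cone k C x = (\<Sum>F\<in>faces_of_dim k C. indicator (face_normal_sum F C) x)"

definition chambers :: "'a::euclidean_space set set \<Rightarrow> 'a set set" where
  "chambers A = closure ` components (UNIV - \<Union>A)"

definition V_arr :: "nat \<Rightarrow> 'a::euclidean_space set set \<Rightarrow> 'a \<Rightarrow> int" where
  "V_arr k A x = (\<Sum>C\<in>chambers A. V_cone k C x)"

text \<open>The empty intersection is \<open>\<Inter>{} = UNIV\<close>, so the whole space is a flat.\<close>

definition flats :: "'a::euclidean_space set set \<Rightarrow> 'a set set" where
  "flats A = {\<Inter>B |B. B \<subseteq> A}"

text \<open>The Moebius function of a finite family \<open>P\<close> of sets ordered by reverse inclusion
  (\<open>X \<le> Y\<close> iff \<open>Y \<subseteq> X\<close>), with \<open>\<mu>(X,X) = 1\<close> and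
  \<open>\<mu>(X,Y) = - (\<Sum>X \<le> Z < Y. \<mu>(X,Z))\<close> for \<open>X < Y\<close>.
  Finiteness of \<open>P\<close> is tested only to make the recursion terminate.\<close>

function moebius :: "'a set set \<Rightarrow> 'a set \<Rightarrow> 'a set \<Rightarrow> int" where
  "moebius P X Y =
     (if X = Y then 1
      else if finite P \<and> Y \<subset> X then - (\<Sum>Z\<in>{Z\<in>P. Z \<subseteq> X \<and> Y \<subset> Z}. moebius P X Z)
      else 0)"
  by pat_completeness auto
termination
proof (relation "Wellfounded.measure (\<lambda>(P, X, Y). card {Z\<in>P. Y \<subset> Z})", goal_cases)
  case (2 P X Y Z)
  then have "{W\<in>P. Z \<subset> W} \<subset> {W\<in>P. Y \<subset> W}" by blast
  with 2 show ?case by (simp add: psubset_card_mono)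
qed simp

declare moebius.simps [simp del]

definition whitney :: "nat \<Rightarrow> 'a::euclidean_space set set \<Rightarrow> int" where
  "whitney k A = (\<Sum>L\<in>{L\<in>flats A. dim L = k}. \<bar>moebius (flats A) UNIV L\<bar>)"

definition restriction :: "'a::euclidean_space set set \<Rightarrow> 'a set \<Rightarrow> 'a set set" where
  "restriction A L = {H \<inter> L |H. H \<in> A \<and> \<not> L \<subseteq> H}"

text \<open>For an arrangement \<open>A'\<close> in the subspace \<open>U\<close>, the arrangement \<open>A' + U\<^sup>\<bottom>\<close> in
  the ambient space.\<close>

definition lift_arrangement :: "'a::euclidean_space set set \<Rightarrow> 'a set \<Rightarrow> 'a set set" where
  "lift_arrangement A' U = {H + U\<^sup>\<bottom> |H. H \<in> A'}"

definition Pi_arr :: "'a::euclidean_space set set \<Rightarrow> 'a set set" where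
  "Pi_arr A = (\<Union>L\<in>flats A. lift_arrangement (restriction A L) L)"

end

theory Submission
  imports Defs
begin

text \<open>
  Let \<open>F\<close> be a face of a chamber \<open>C\<close>, let \<open>L\<close> be the flat that it spans and let \<open>q\<close> be the orthogonal
  projection of \<open>x\<close> to \<open>L\<close>. Then \<open>x\<close> lies in \<open>F + N\<^sub>F C\<close> iff \<open>q\<close> lies in \<open>F\<close> and
  \<open>x - q\<close> has nonpositive inner product with all points of \<open>C\<close> (\<open>mem_face_normal_sum_iff\<close>). For
  fixed \<open>F\<close>, the chambers having \<open>F\<close> as a face correspond to the chambers of the localization
  \<open>A\<^sub>L\<close> of all hyperplanes containing \<open>L\<close>, and the condition on \<open>x - q\<close> can be tested there
  (\<open>card_chambers_below\<close>). Hence \<open>V\<^sub>k(A)(x)\<close> is the sum of \<open>m\<^sub>L n\<^sub>L\<close> over the flats \<open>L\<close> of dimension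
  \<open>k\<close>, where \<open>m\<^sub>L\<close> counts the closed chambers of \<open>A/L\<close> that contain \<open>q\<close>, and \<open>n\<^sub>L\<close> counts the chambers of
  \<open>A\<^sub>L\<close> on which \<open>x - q\<close> is nonpositive (\<open>V_arr_eq_sum_over_flats\<close>).

  This is compared term by term with \<open>w\<^sub>k\<close>, the sum of the absolute Moebius numbers of these flats.
  The factor \<open>m\<^sub>L\<close> is 1 if \<open>q\<close> is on no hyperplane of \<open>A/L\<close>, and at least 2 otherwise. The factor
  \<open>n\<^sub>L\<close> is always at least the absolute Moebius number of \<open>L\<close>, which is positive, with equality if
  \<open>x - q\<close> is orthogonal to no flat that properly contains \<open>L\<close>. The reason is that
  \<open>n\<^sub>L\<close> and the absolute Moebius number obey the same deletion-restriction recurrence and differ only in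
  its base case (\<open>abs_moebius_le_card_sectors_below\<close>, \<open>card_sectors_below_eq_abs_moebius\<close>). The
  Moebius number enters as an alternating sum over the sets of hyperplanes with intersection \<open>L\<close>
  (\<open>moebius_flats_eq_alternating_sum\<close>).

  Both sources of strictness are governed by \<open>\<Pi>(A)\<close>. On the one hand, \<open>q\<close> lies on the hyperplane
  \<open>H \<inter> L\<close> of \<open>A/L\<close> iff \<open>x\<close> lies in \<open>(H \<inter> L) + L\<^sup>\<bottom>\<close>. On the other hand, if \<open>x - q\<close> is orthogonal to a flat
  \<open>M\<close> properly containing \<open>L\<close>, then \<open>q\<close> is also the projection of \<open>x\<close> to \<open>M\<close>, and it lies on
  \<open>H \<inter> M\<close> for any hyperplane \<open>H\<close> that contains \<open>L\<close> but not \<open>M\<close>; so again \<open>x\<close> is in \<open>\<Pi>(A)\<close>.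
\<close>

section \<open>Deletion and restriction for sectors on one side of a hyperplane\<close>

text \<open>A sign vector on \<open>I\<close> without zeros is encoded by the set \<open>T\<close> of its positive positions.\<close>

definition sector :: "('b \<Rightarrow> 'a::euclidean_space) \<Rightarrow> 'b set \<Rightarrow> 'b set \<Rightarrow> 'a set" where
  "sector a I T = {y. \<forall>i\<in>I. if i \<in> T then a i \<bullet> y > 0 else a i \<bullet> y < 0}"

definition flat_of :: "('b \<Rightarrow> 'a::euclidean_space) \<Rightarrow> 'b set \<Rightarrow> 'a set" where
  "flat_of a S = {y. \<forall>i\<in>S. a i \<bullet> y = 0}"

definition below :: "'a::euclidean_space \<Rightarrow> 'a set \<Rightarrow> bool" where
  "below u K \<longleftrightarrow> K \<noteq> {} \<and> (\<forall>y\<in>K. u \<bullet> y \<le> 0)"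

text \<open>The subspace \<open>W\<close> carries the restricted arrangements: restricting to a hyperplane shrinks \<open>W\<close>
  and keeps the normal vectors \<open>a\<close>, so that parallel or vanishing restrictions need no special
  bookkeeping.\<close>

definition sectors_below :: "('b \<Rightarrow> 'a::euclidean_space) \<Rightarrow> 'b set \<Rightarrow> 'a set \<Rightarrow> 'a \<Rightarrow> 'b set set" where
  "sectors_below a I W u = {T \<in> Pow I. below u (sector a I T \<inter> W)}"

text \<open>Whitney's expression for the Moebius number of the flat \<open>L\<close> in the arrangement that the
  hyperplanes orthogonal to \<open>a i\<close> cut out on \<open>W\<close>. In this form repeated hyperplanes do no harm, and the number is 0
  if some hyperplane contains \<open>W\<close>.\<close>

definition signed_count :: "('b \<Rightarrow> 'a::euclidean_space) \<Rightarrow> 'b set \<Rightarrow> 'a set \<Rightarrow> 'a set \<Rightarrow> int" where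
  "signed_count a I W L = (\<Sum>S\<in>Pow I. of_bool (W \<inter> flat_of a S = L) * (- 1) ^ card S)"

lemma subspace_flat_of: "subspace (flat_of a S)"
  by (auto simp: flat_of_def subspace_def inner_add_right)

lemma flat_of_insert: "flat_of a (insert i S) = flat_of a {i} \<inter> flat_of a S"
  by (auto simp: flat_of_def)

lemma convex_sector: "convex (sector a I T)"
proof -
  have "sector a I T = (\<Inter>i\<in>I. if i \<in> T then {y. a i \<bullet> y > 0} else {y. a i \<bullet> y < 0})"
    by (auto simp: sector_def split: if_splits)
  moreover have "convex (if i \<in> T then {y. a i \<bullet> y > 0} else {y. a i \<bullet> y < 0})" for i
    by (simp add: convex_halfspace_gt convex_halfspace_lt)
  ultimately show ?thesis
    by (simp only:) (intro convex_INT)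
qed

lemma open_sector:
  assumes "finite I"
  shows "open (sector a I T)"
proof -
  have "sector a I T = (\<Inter>i\<in>I. if i \<in> T then {y. a i \<bullet> y > 0} else {y. a i \<bullet> y < 0})"
    by (auto simp: sector_def split: if_splits)
  moreover have "open (if i \<in> T then {y. a i \<bullet> y > 0} else {y. a i \<bullet> y < 0})" for i
    by (simp add: open_halfspace_gt open_halfspace_lt)
  ultimately show ?thesis
    using assms by (simp only:) (intro open_INT ballI)
qed

lemma open_prolongation:
  fixes y w :: "'a::real_normed_vector"
  assumes "open U" "y \<in> U"
  obtains e where "e > 0" "y + e *\<^sub>R w \<in> U" "y - e *\<^sub>R w \<in> U"
proof -
  obtain r where r: "r > 0" "ball y r \<subseteq> U"
    using assms open_contains_ball by blast
  define e where "e = r / (2 * (norm w + 1))"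
  have nw: "norm w + 1 > 0"
    by (smt (verit) norm_ge_zero)
  have "e > 0"
    using r nw by (simp add: e_def)
  have "e * norm w < r"
  proof -
    have "e * norm w \<le> e * (norm w + 1)"
      using \<open>e > 0\<close> by (simp add: algebra_simps)
    also have "\<dots> = r / 2"
      using nw by (simp add: e_def field_simps)
    finally show ?thesis
      using r by simp
  qed
  then have "y + e *\<^sub>R w \<in> ball y r" "y - e *\<^sub>R w \<in> ball y r"
    using \<open>e > 0\<close> by (auto simp: dist_norm)
  with that \<open>e > 0\<close> r show thesis
    by blast
qed

text \<open>The geometric core of the deletion-restriction recurrence. A hyperplane that misses
  the convex set leaves it on one side. If it cuts the set, both halves
  are nonempty, and there are three possibilities for the part where \<open>u\<close> is positive:
  it is empty (both sides of the identity are 2), it meets the hyperplane and hence by openness both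
  halves (both are 0), or it is nonempty but misses the hyperplane and lies by convexity in
  exactly one half (both are 1).\<close>

lemma below_cut:
  fixes h :: "'a::euclidean_space"
  assumes "convex U" "open U" "subspace W" "\<not> W \<subseteq> {y. h \<bullet> y = 0}"
  shows "(of_bool (below u (U \<inter> {y. h \<bullet> y < 0} \<inter> W)) + of_bool (below u (U \<inter> {y. h \<bullet> y > 0} \<inter> W)) :: int)
       = of_bool (below u (U \<inter> W)) + of_bool (below u (U \<inter> (W \<inter> {y. h \<bullet> y = 0})))"
proof -
  define K where "K = U \<inter> W"
  define neg where "neg = K \<inter> {y. h \<bullet> y < 0}"
  define pos where "pos = K \<inter> {y. h \<bullet> y > 0}"
  define zer where "zer = K \<inter> {y. h \<bullet> y = 0}"
  obtain w where w: "w \<in> W" "h \<bullet> w > 0"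
  proof -
    obtain w0 where "w0 \<in> W" "h \<bullet> w0 \<noteq> 0"
      using assms by auto
    then show thesis
      using that[of w0] that[of "- w0"] subspace_neg[OF \<open>subspace W\<close>, of w0]
      by (cases "h \<bullet> w0 > 0") auto
  qed
  have cK: "convex K"
    using assms by (simp add: K_def convex_Int subspace_imp_convex)
  \<comment> \<open>a segment from one half to the other crosses the hyperplane, and what is positive at its ends is positive at the crossing point\<close>
  have cross: "\<exists>y\<in>zer. \<forall>c. p \<bullet> c > 0 \<and> q \<bullet> c > 0 \<longrightarrow> y \<bullet> c > 0" if "p \<in> neg" "q \<in> pos" for p q
  proof -
    define s where "s = (h \<bullet> q) / (h \<bullet> q - h \<bullet> p)"
    have hp: "h \<bullet> p < 0" "h \<bullet> q > 0"
      using that by (auto simp: neg_def pos_def)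
    then have s: "0 < s" "s < 1"
      by (auto simp: s_def field_simps)
    let ?y = "s *\<^sub>R p + (1 - s) *\<^sub>R q"
    have "?y \<in> K"
      using that s cK by (intro convexD) (auto simp: neg_def pos_def)
    moreover have "h \<bullet> ?y = 0"
      using hp by (simp add: s_def inner_add_right divide_simps) (simp add: algebra_simps)
    moreover have "?y \<bullet> c > 0" if "p \<bullet> c > 0 \<and> q \<bullet> c > 0" for c
      using that s by (auto simp: inner_add_left intro!: add_pos_pos mult_pos_pos)
    ultimately show ?thesis
      by (auto simp: zer_def)
  qed
  \<comment> \<open>a point of the hyperplane can be pushed to either side within \<open>U\<close> and, if \<open>u\<close> is positive there, keeping \<open>u\<close> positive\<close>
  have split: "\<exists>p\<in>neg. \<exists>q\<in>pos. (u \<bullet> y > 0 \<longrightarrow> u \<bullet> p > 0 \<and> u \<bullet> q > 0)" if "y \<in> zer" for y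
  proof -
    define U' where "U' = (if u \<bullet> y > 0 then U \<inter> {z. u \<bullet> z > 0} else U)"
    have "open U'" "y \<in> U'"
      using that assms by (auto simp: U'_def zer_def K_def open_halfspace_gt intro!: open_Int)
    then obtain e where e: "e > 0" "y + e *\<^sub>R w \<in> U'" "y - e *\<^sub>R w \<in> U'"
      by (rule open_prolongation)
    have "y \<in> W" "h \<bullet> y = 0"
      using that by (auto simp: zer_def K_def)
    moreover have "y + e *\<^sub>R w \<in> W" "y - e *\<^sub>R w \<in> W"
      using \<open>y \<in> W\<close> w assms by (auto intro!: subspace_add subspace_diff subspace_scale)
    ultimately have "y - e *\<^sub>R w \<in> neg" "y + e *\<^sub>R w \<in> pos"
      using e w by (auto simp: neg_def pos_def K_def U'_def inner_add_right inner_diff_right split: if_splits)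
    then show ?thesis
      using e by (fastforce simp: U'_def split: if_splits)
  qed
  have K: "K = neg \<union> zer \<union> pos"
    by (auto simp: neg_def zer_def pos_def)
  have "(of_bool (below u neg) + of_bool (below u pos) :: int) = of_bool (below u K) + of_bool (below u zer)"
  proof (cases "zer = {}")
    case True
    then have "neg = {} \<or> pos = {}"
      using cross by blast
    then show ?thesis
      using True K by (auto simp: below_def)
  next
    case False
    then have ne: "neg \<noteq> {}" "pos \<noteq> {}" "K \<noteq> {}"
      using split K by blast+
    have 1: "below u zer" if "below u neg \<or> below u pos"
      using that split False by (meson below_def linorder_not_le)
    have 2: "below u neg \<or> below u pos" if "below u zer"
    proof (rule ccontr)
      assume "\<not> ?thesis"
      then obtain p q where "p \<in> neg" "q \<in> pos" "u \<bullet> p > 0" "u \<bullet> q > 0"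
        using ne by (auto simp: below_def not_le)
      with cross obtain y where "y \<in> zer" "u \<bullet> y > 0"
        by (metis inner_commute)
      with that show False
        by (force simp: below_def)
    qed
    have 3: "below u K \<longleftrightarrow> below u neg \<and> below u pos \<and> below u zer"
      using ne False by (auto simp: below_def K)
    show ?thesis
      using 1 2 3 by auto
  qed
  then show ?thesis
    by (simp add: K_def neg_def pos_def zer_def Int_ac)
qed

lemma card_sectors_below:
  assumes "finite I"
  shows "int (card (sectors_below a I W u)) = (\<Sum>T\<in>Pow I. of_bool (below u (sector a I T \<inter> W)))"
proof -
  have "sectors_below a I W u = Pow I \<inter> {T. below u (sector a I T \<inter> W)}"
    by (auto simp: sectors_below_def)
  then show ?thesis
    using assms by simp
qed

lemma sum_Pow_insert:
  fixes f :: "'b set \<Rightarrow> int"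
  assumes "finite I" "i \<notin> I"
  shows "(\<Sum>T\<in>Pow (insert i I). f T) = (\<Sum>T\<in>Pow I. f T) + (\<Sum>T\<in>Pow I. f (insert i T))"
proof -
  have "(\<Sum>T\<in>Pow (insert i I). f T) = (\<Sum>T\<in>Pow I. f T) + (\<Sum>T\<in>insert i ` Pow I. f T)"
    unfolding Pow_insert using assms by (intro sum.union_disjoint) auto
  also have "(\<Sum>T\<in>insert i ` Pow I. f T) = (\<Sum>T\<in>Pow I. f (insert i T))"
  proof (subst sum.reindex)
    show "inj_on (insert i) (Pow I)"
      using assms by (intro inj_onI) (metis PowD insert_ident subsetD)
  qed simp
  finally show ?thesis .
qed

lemma sector_insert:
  assumes "i \<notin> I" "T \<subseteq> I"
  shows "sector a (insert i I) T = sector a I T \<inter> {y. a i \<bullet> y < 0}"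
    and "sector a (insert i I) (insert i T) = sector a I T \<inter> {y. a i \<bullet> y > 0}"
proof -
  have "j \<noteq> i" if "j \<in> I" for j
    using that assms by blast
  moreover have "i \<notin> T"
    using assms by blast
  ultimately show "sector a (insert i I) T = sector a I T \<inter> {y. a i \<bullet> y < 0}"
    and "sector a (insert i I) (insert i T) = sector a I T \<inter> {y. a i \<bullet> y > 0}"
    unfolding sector_def by auto
qed

lemma card_sectors_below_insert:
  assumes "finite I" "i \<notin> I" "subspace W" "\<not> W \<subseteq> flat_of a {i}"
  shows "card (sectors_below a (insert i I) W u)
       = card (sectors_below a I W u) + card (sectors_below a I (W \<inter> flat_of a {i}) u)"
proof -
  have k: "flat_of a {i} = {y. a i \<bullet> y = 0}"
    by (simp add: flat_of_def)
  have "int (card (sectors_below a (insert i I) W u))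
      = (\<Sum>T\<in>Pow I. of_bool (below u (sector a I T \<inter> {y. a i \<bullet> y < 0} \<inter> W))
          + of_bool (below u (sector a I T \<inter> {y. a i \<bullet> y > 0} \<inter> W)))"
    using assms by (simp add: card_sectors_below sum_Pow_insert sector_insert sum.distrib del: sum_of_bool_eq Pow_insert)
  also have "\<dots> = (\<Sum>T\<in>Pow I. of_bool (below u (sector a I T \<inter> W))
          + of_bool (below u (sector a I T \<inter> (W \<inter> flat_of a {i}))))"
    unfolding k by (intro sum.cong refl below_cut) (use assms k in \<open>auto simp: convex_sector open_sector\<close>)
  also have "\<dots> = int (card (sectors_below a I W u) + card (sectors_below a I (W \<inter> flat_of a {i}) u))"
    using assms by (simp add: card_sectors_below sum.distrib del: sum_of_bool_eq)
  finally show ?thesis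
    by linarith
qed

lemma signed_count_insert:
  assumes "finite I" "i \<notin> I"
  shows "signed_count a (insert i I) W L = signed_count a I W L - signed_count a I (W \<inter> flat_of a {i}) L"
proof -
  have "(\<Sum>S\<in>Pow I. of_bool (W \<inter> flat_of a (insert i S) = L) * (- 1) ^ card (insert i S))
      = (\<Sum>S\<in>Pow I. - (of_bool (W \<inter> flat_of a {i} \<inter> flat_of a S = L) * (- 1) ^ card S) :: int)"
  proof (rule sum.cong)
    fix S assume "S \<in> Pow I"
    then have "card (insert i S) = Suc (card S)"
      using assms by (meson PowD card_insert_disjoint finite_subset subsetD)
    then show "of_bool (W \<inter> flat_of a (insert i S) = L) * (- 1) ^ card (insert i S)
      = - (of_bool (W \<inter> flat_of a {i} \<inter> flat_of a S = L) * (- 1) ^ card S :: int)"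
      by (subst flat_of_insert) (simp add: Int_assoc)
  qed simp
  then show ?thesis
    using assms by (simp add: signed_count_def sum_Pow_insert sum_negf del: sum_of_bool_mult_eq Pow_insert)
qed

text \<open>The exponent has the parity of \<open>dim W - dim L\<close>, which is the sign of the Moebius number.\<close>

definition abs_moebius :: "('b \<Rightarrow> 'a::euclidean_space) \<Rightarrow> 'b set \<Rightarrow> 'a set \<Rightarrow> 'a set \<Rightarrow> int" where
  "abs_moebius a I W L = (- 1) ^ (dim W + dim L) * signed_count a I W L"

lemma dim_Int_hyperplane:
  fixes h :: "'a::euclidean_space"
  assumes "subspace W" "\<not> W \<subseteq> {y. h \<bullet> y = 0}"
  shows "dim W = Suc (dim (W \<inter> {y. h \<bullet> y = 0}))"
proof -
  let ?H = "{y. h \<bullet> y = 0}"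
  have "h \<noteq> 0" using assms by auto
  then have dH: "dim ?H = DIM('a) - 1" by (rule dim_hyperplane)
  have sH: "subspace ?H" by (rule subspace_hyperplane)
  have "dim {x + y |x y. x \<in> W \<and> y \<in> ?H} + dim (W \<inter> ?H) = dim W + dim ?H"
    by (rule dim_sums_Int[OF assms(1) sH])
  moreover have "dim {x + y |x y. x \<in> W \<and> y \<in> ?H} = DIM('a)"
  proof -
    let ?S = "{x + y |x y. x \<in> W \<and> y \<in> ?H}"
    have "subspace ?S" by (rule subspace_sums[OF assms(1) sH])
    moreover have "?H \<subset> ?S"
    proof
      show "?H \<subseteq> ?S" using subspace_0[OF assms(1)] by force
      obtain w where "w \<in> W" "w \<notin> ?H" using assms by auto
      moreover have "w \<in> ?S" using \<open>w \<in> W\<close> by force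
      ultimately show "?H \<noteq> ?S" by blast
    qed
    ultimately have "dim ?H < dim ?S"
      using sH by (intro dim_psubset) (simp only: span_eq_iff[THEN iffD2])
    moreover have "dim ?S \<le> DIM('a)" by (rule dim_subset_UNIV)
    ultimately show ?thesis using dH by linarith
  qed
  ultimately show ?thesis using dH using DIM_positive[where 'a='a] by linarith
qed

text \<open>Subsets with and without \<open>i\<close> cancel in pairs.\<close>

lemma abs_moebius_loop:
  assumes "finite I" "i \<notin> I" "W \<subseteq> flat_of a {i}"
  shows "abs_moebius a (insert i I) W L = 0"
proof -
  have "W \<inter> flat_of a {i} = W" using assms by blast
  then show ?thesis
    using assms by (simp add: abs_moebius_def signed_count_insert)
qed

text \<open>Restriction flips the sign in \<open>signed_count_insert\<close>, and lowers the dimension of the ambient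
  space by one; the two signs cancel, which makes this recurrence identical to
  \<open>card_sectors_below_insert\<close>.\<close>

lemma abs_moebius_insert:
  assumes "finite I" "i \<notin> I" "subspace W" "\<not> W \<subseteq> flat_of a {i}"
  shows "abs_moebius a (insert i I) W L = abs_moebius a I W L + abs_moebius a I (W \<inter> flat_of a {i}) L"
proof -
  have "dim W = Suc (dim (W \<inter> flat_of a {i}))"
    using dim_Int_hyperplane[of W "a i"] assms by (simp add: flat_of_def)
  then show ?thesis
    using assms by (simp add: abs_moebius_def signed_count_insert algebra_simps)
qed

lemma abs_moebius_empty: "abs_moebius a {} W L = of_bool (W = L)"
proof -
  have "flat_of a {} = UNIV"
    by (simp add: flat_of_def)
  then have "signed_count a {} W L = of_bool (W = L)"
    by (simp add: signed_count_def)
  then show ?thesis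
    by (cases "W = L") (simp_all add: abs_moebius_def flip: mult_2)
qed

lemma abs_moebius_nonneg:
  assumes "finite I" "subspace W"
  shows "abs_moebius a I W L \<ge> 0"
  using assms
proof (induction I arbitrary: W rule: finite_induct)
  case (insert i I)
  show ?case
  proof (cases "W \<subseteq> flat_of a {i}")
    case False
    then show ?thesis
      using insert by (simp add: abs_moebius_insert subspace_inter subspace_flat_of)
  qed (use insert in \<open>simp add: abs_moebius_loop\<close>)
qed (simp add: abs_moebius_empty)

text \<open>Induction through the recurrence. Restriction to the hyperplane of \<open>i\<close> keeps the hypotheses
  unless some other \<open>j\<close> defines the same hyperplane of \<open>W\<close>; then \<open>i\<close> is redundant and
  deletion keeps the hypotheses.\<close>

lemma abs_moebius_pos:
  assumes "finite I" "subspace W" "\<And>i. i \<in> I \<Longrightarrow> \<not> W \<subseteq> flat_of a {i}" "W \<inter> flat_of a I = L"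
  shows "abs_moebius a I W L > 0"
  using assms
proof (induction I arbitrary: W rule: finite_induct)
  case empty
  then show ?case by (simp add: abs_moebius_empty flat_of_def)
next
  case (insert i I)
  let ?W' = "W \<inter> flat_of a {i}"
  have W': "subspace ?W'"
    using insert by (simp add: subspace_inter subspace_flat_of)
  have L: "L = ?W' \<inter> flat_of a I"
    using insert.prems by (subst (asm) flat_of_insert) auto
  have split: "abs_moebius a (insert i I) W L = abs_moebius a I W L + abs_moebius a I ?W' L"
    using insert by (intro abs_moebius_insert) auto
  show ?case
  proof (cases "\<exists>j\<in>I. ?W' \<subseteq> flat_of a {j}")
    case False
    then have "abs_moebius a I ?W' L > 0"
      using insert W' L by (intro insert.IH) auto
    then show ?thesis
      using split abs_moebius_nonneg[of I W a L] insert by simp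
  next
    case True
    then obtain j where j: "j \<in> I" "?W' \<subseteq> flat_of a {j}" by blast
    have "W \<inter> flat_of a {j} = ?W'"
    proof -
      have "dim W = Suc (dim ?W')" "dim W = Suc (dim (W \<inter> flat_of a {j}))"
        using dim_Int_hyperplane[of W "a i"] dim_Int_hyperplane[of W "a j"] insert.prems j
        by (auto simp: flat_of_def)
      then have "?W' = W \<inter> flat_of a {j}"
        using W' j insert.prems(1)
        by (intro subspace_dim_equal) (auto simp: subspace_inter subspace_flat_of)
      then show ?thesis ..
    qed
    then have "W \<inter> flat_of a I = L"
      using j L by (auto simp: flat_of_def)
    then have "abs_moebius a I W L > 0"
      using insert by (intro insert.IH) auto
    then show ?thesis
      using split abs_moebius_nonneg[of I ?W' a L] insert W' by simp
  qed
qed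

text \<open>Both sides obey the same recurrence as long as the hyperplane does not contain \<open>W\<close>, and otherwise the
  left side is 0. So only the empty family matters: there the left side tests \<open>W = L\<close> and the right
  side tests whether \<open>u\<close> vanishes on \<open>W\<close>, which is a weaker condition.\<close>

lemma abs_moebius_le_card_sectors_below:
  assumes "finite I" "subspace W" "\<And>y. y \<in> L \<Longrightarrow> u \<bullet> y = 0"
  shows "abs_moebius a I W L \<le> int (card (sectors_below a I W u))"
  using assms(1,2)
proof (induction I arbitrary: W rule: finite_induct)
  case empty
  have "below u W" if "W = L"
    using that assms(3) subspace_0[OF empty] by (auto simp: below_def)
  then show ?case
    by (auto simp: abs_moebius_empty sectors_below_def sector_def)
next
  case (insert i I)
  show ?case
  proof (cases "W \<subseteq> flat_of a {i}")
    case False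
    then show ?thesis
      using insert.IH[of W] insert.IH[of "W \<inter> flat_of a {i}"] insert.hyps insert.prems
      by (simp add: abs_moebius_insert card_sectors_below_insert subspace_inter subspace_flat_of add_mono)
  qed (use insert in \<open>simp add: abs_moebius_loop\<close>)
qed

text \<open>The genericity hypothesis makes the two tests in the base case agree. It is inherited by
  deletion and by restriction, since their flats are flats of the original family.\<close>

lemma card_sectors_below_eq_abs_moebius:
  assumes "finite I" "subspace W"
    and "\<And>S. S \<subseteq> I \<Longrightarrow> (\<forall>y\<in>W \<inter> flat_of a S. u \<bullet> y = 0) \<longleftrightarrow> W \<inter> flat_of a S = L"
  shows "int (card (sectors_below a I W u)) = abs_moebius a I W L"
  using assms
proof (induction I arbitrary: W rule: finite_induct)
  case empty
  have "u \<bullet> y = 0" if "below u W" "y \<in> W" for y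
  proof -
    have "u \<bullet> y \<le> 0" "u \<bullet> (- y) \<le> 0"
      using that subspace_neg[OF empty(1)] by (auto simp only: below_def)
    then show ?thesis
      by simp
  qed
  then have "below u W \<longleftrightarrow> (\<forall>y\<in>W. u \<bullet> y = 0)"
    using subspace_0[OF empty(1)] by (auto simp: below_def)
  also have "\<dots> \<longleftrightarrow> W = L"
    using empty(2)[of "{}"] by (simp add: flat_of_def)
  finally have "sectors_below a {} W u = (if W = L then {{}} else {})"
    by (auto simp: sectors_below_def sector_def)
  then show ?case
    by (simp add: abs_moebius_empty)
next
  case (insert i I)
  show ?case
  proof (cases "W \<subseteq> flat_of a {i}")
    case False
    have "int (card (sectors_below a I W u)) = abs_moebius a I W L"
      using insert.prems by (intro insert.IH) auto
    moreover have "int (card (sectors_below a I (W \<inter> flat_of a {i}) u)) = abs_moebius a I (W \<inter> flat_of a {i}) L"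
    proof (rule insert.IH)
      show "subspace (W \<inter> flat_of a {i})"
        using insert.prems by (simp add: subspace_inter subspace_flat_of)
      fix S assume "S \<subseteq> I"
      moreover have "W \<inter> flat_of a {i} \<inter> flat_of a S = W \<inter> flat_of a (insert i S)"
        by (subst (2) flat_of_insert) auto
      ultimately show "(\<forall>y\<in>W \<inter> flat_of a {i} \<inter> flat_of a S. u \<bullet> y = 0) \<longleftrightarrow> W \<inter> flat_of a {i} \<inter> flat_of a S = L"
        using insert.prems(2)[of "insert i S"] by (simp add: subset_insertI2)
    qed
    ultimately show ?thesis
      using insert False by (simp add: abs_moebius_insert card_sectors_below_insert)
  next
    case True
    then have "a i \<bullet> y = 0" if "y \<in> W" for y
      using that by (auto simp: flat_of_def)
    moreover have "a i \<bullet> y \<noteq> 0" if "y \<in> sector a (insert i I) T" for y T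
      using that by (auto simp: sector_def split: if_splits)
    ultimately have "sector a (insert i I) T \<inter> W = {}" for T
      by blast
    then have "sectors_below a (insert i I) W u = {}"
      by (auto simp: sectors_below_def below_def)
    with True insert show ?thesis
      by (simp add: abs_moebius_loop)
  qed
qed

section \<open>Closed cells as faces of chambers\<close>

text \<open>The closed face of the arrangement with \<open>p\<close> in its relative interior.\<close>

definition closed_cell :: "('b \<Rightarrow> 'a::euclidean_space) \<Rightarrow> 'b set \<Rightarrow> 'a \<Rightarrow> 'a set" where
  "closed_cell a I p = {z. \<forall>i\<in>I. a i \<bullet> z = 0 \<or> sgn (a i \<bullet> z) = sgn (a i \<bullet> p)}"

definition zeros :: "('b \<Rightarrow> 'a::euclidean_space) \<Rightarrow> 'b set \<Rightarrow> 'a \<Rightarrow> 'b set" where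
  "zeros a I p = {i\<in>I. a i \<bullet> p = 0}"

lemma self_in_closed_cell: "p \<in> closed_cell a I p"
  by (simp add: closed_cell_def)

lemma zero_in_closed_cell: "0 \<in> closed_cell a I p"
  by (simp add: closed_cell_def)

lemma closed_cell_mono:
  assumes "p \<in> closed_cell a I y"
  shows "closed_cell a I p \<subseteq> closed_cell a I y"
proof
  fix z assume "z \<in> closed_cell a I p"
  with assms show "z \<in> closed_cell a I y"
    unfolding closed_cell_def mem_Collect_eq by (metis sgn_0_0)
qed

lemma closed_cell_eq_iff:
  "closed_cell a I p = closed_cell a I p' \<longleftrightarrow> (\<forall>i\<in>I. sgn (a i \<bullet> p) = sgn (a i \<bullet> p'))"
proof
  assume eq: "closed_cell a I p = closed_cell a I p'"
  then have "p \<in> closed_cell a I p'" "p' \<in> closed_cell a I p"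
    using self_in_closed_cell by blast+
  then show "\<forall>i\<in>I. sgn (a i \<bullet> p) = sgn (a i \<bullet> p')"
    unfolding closed_cell_def mem_Collect_eq by (metis sgn_0_0)
qed (simp add: closed_cell_def)

lemma closed_cell_eq_halfspaces:
  "closed_cell a I p = {z. \<forall>i\<in>I. (a i \<bullet> p \<le> 0 \<longrightarrow> a i \<bullet> z \<le> 0) \<and> (a i \<bullet> p \<ge> 0 \<longrightarrow> a i \<bullet> z \<ge> 0)}"
proof -
  have "(s = 0 \<or> sgn s = sgn t) \<longleftrightarrow> (t \<le> 0 \<longrightarrow> s \<le> 0) \<and> (t \<ge> 0 \<longrightarrow> s \<ge> 0)" for s t :: real
    by (auto simp: sgn_if)
  then show ?thesis
    by (simp add: closed_cell_def)
qed

lemma convex_closed_cell: "convex (closed_cell a I p)"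
proof -
  have "closed_cell a I p = (\<Inter>i\<in>I. (if a i \<bullet> p \<le> 0 then {z. a i \<bullet> z \<le> 0} else UNIV)
      \<inter> (if a i \<bullet> p \<ge> 0 then {z. a i \<bullet> z \<ge> 0} else UNIV))"
    by (auto simp: closed_cell_eq_halfspaces split: if_splits)
  moreover have "convex ((if a i \<bullet> p \<le> 0 then {z. a i \<bullet> z \<le> 0} else UNIV)
      \<inter> (if a i \<bullet> p \<ge> 0 then {z. a i \<bullet> z \<ge> 0} else UNIV))" for i
    by (simp add: convex_Int convex_halfspace_ge convex_halfspace_le)
  ultimately show ?thesis
    by (simp only:) (intro convex_INT)
qed

lemma closed_closed_cell: "closed (closed_cell a I p)"
proof -
  have "closed_cell a I p = (\<Inter>i\<in>I. (if a i \<bullet> p \<le> 0 then {z. a i \<bullet> z \<le> 0} else UNIV)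
      \<inter> (if a i \<bullet> p \<ge> 0 then {z. a i \<bullet> z \<ge> 0} else UNIV))"
    by (auto simp: closed_cell_eq_halfspaces split: if_splits)
  moreover have "closed ((if a i \<bullet> p \<le> 0 then {z. a i \<bullet> z \<le> 0} else UNIV)
      \<inter> (if a i \<bullet> p \<ge> 0 then {z. a i \<bullet> z \<ge> 0} else UNIV))" for i
    by (simp add: closed_Int closed_halfspace_ge closed_halfspace_le)
  ultimately show ?thesis
    by (simp only:) (intro closed_INT ballI)
qed

text \<open>The shape in which openness of sign conditions is used: a small move in either direction can only
  affect the signs that are zero at the start.\<close>

lemma sgn_preserving_prolongation:
  fixes a :: "'b \<Rightarrow> 'a::euclidean_space"
  assumes "finite I"
  obtains e where "e > 0"
    "\<And>i. i \<in> I \<Longrightarrow> a i \<bullet> p \<noteq> 0 \<Longrightarrow> sgn (a i \<bullet> (p + e *\<^sub>R w)) = sgn (a i \<bullet> p)"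
    "\<And>i. i \<in> I \<Longrightarrow> a i \<bullet> p \<noteq> 0 \<Longrightarrow> sgn (a i \<bullet> (p - e *\<^sub>R w)) = sgn (a i \<bullet> p)"
proof -
  define U where "U = sector a {i\<in>I. a i \<bullet> p \<noteq> 0} {i. a i \<bullet> p > 0}"
  have "open U" "p \<in> U"
    using assms by (auto simp: U_def open_sector) (auto simp: sector_def)
  then obtain e where e: "e > 0" "p + e *\<^sub>R w \<in> U" "p - e *\<^sub>R w \<in> U"
    by (rule open_prolongation)
  have U: "sgn (a i \<bullet> v) = sgn (a i \<bullet> p)" if "i \<in> I" "a i \<bullet> p \<noteq> 0" "v \<in> U" for i v
    using that by (auto simp: U_def sector_def sgn_if split: if_splits)
  show thesis
    using that[of e] e U by blast
qed

lemma mem_sector_iff_sgn: "z \<in> sector a I T \<longleftrightarrow> (\<forall>i\<in>I. sgn (a i \<bullet> z) = (if i \<in> T then 1 else - 1))"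
  by (auto simp: sector_def sgn_1_pos sgn_1_neg)

lemma sector_eq_sgn:
  assumes "y \<in> sector a I T"
  shows "sector a I T = {z. \<forall>i\<in>I. sgn (a i \<bullet> z) = sgn (a i \<bullet> y)}"
  using assms by (auto simp: mem_sector_iff_sgn)

lemma sector_nonzero: "y \<in> sector a I T \<Longrightarrow> i \<in> I \<Longrightarrow> a i \<bullet> y \<noteq> 0"
  by (auto simp: sector_def split: if_splits)

lemma mem_own_sector:
  assumes "\<And>i. i \<in> I \<Longrightarrow> a i \<bullet> y \<noteq> 0"
  shows "y \<in> sector a I {i\<in>I. a i \<bullet> y > 0}"
  using assms by (simp add: mem_sector_iff_sgn sgn_if)

text \<open>Adding a small multiple of an interior point to a point of the closed cell leads into the sector.\<close>

lemma closure_sector: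
  assumes y: "y \<in> sector a I T"
  shows "closure (sector a I T) = closed_cell a I y"
proof
  show "closure (sector a I T) \<subseteq> closed_cell a I y"
    unfolding sector_eq_sgn[OF y] by (intro closure_minimal closed_closed_cell) (auto simp: closed_cell_def)
  show "closed_cell a I y \<subseteq> closure (sector a I T)"
  proof
    fix z assume z: "z \<in> closed_cell a I y"
    have lim: "((\<lambda>t. z + t *\<^sub>R y) \<longlongrightarrow> z + 0 *\<^sub>R y) (at_right 0)"
      by (intro tendsto_intros)
    have mem: "z + t *\<^sub>R y \<in> sector a I T" if "t > 0" for t
    proof -
      have "sgn (a i \<bullet> (z + t *\<^sub>R y)) = sgn (a i \<bullet> y)" if "i \<in> I" for i
      proof -
        have "a i \<bullet> z = 0 \<or> sgn (a i \<bullet> z) = sgn (a i \<bullet> y)" "a i \<bullet> y \<noteq> 0"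
          using z that sector_nonzero[OF y] by (auto simp: closed_cell_def)
        then consider "a i \<bullet> y > 0" "a i \<bullet> z \<ge> 0" | "a i \<bullet> y < 0" "a i \<bullet> z \<le> 0"
          by (fastforce simp: sgn_if split: if_splits)
        then show ?thesis
        proof cases
          case 1
          then have "a i \<bullet> z + t * (a i \<bullet> y) > 0"
            using \<open>t > 0\<close> by (simp add: add_nonneg_pos)
          then show ?thesis
            using 1 by (simp add: inner_add_right)
        next
          case 2
          then have "a i \<bullet> z + t * (a i \<bullet> y) < 0"
            using \<open>t > 0\<close> by (simp add: add_nonpos_neg mult_pos_neg)
          then show ?thesis
            using 2 by (simp add: inner_add_right)
        qed
      qed
      then show ?thesis
        using sector_eq_sgn[OF y] by blast
    qed
    have "eventually (\<lambda>t. z + t *\<^sub>R y \<in> closure (sector a I T)) (at_right 0)"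
      using mem closure_subset by (auto simp: eventually_at_right_field intro!: exI[of _ 1])
    then have "z + 0 *\<^sub>R y \<in> closure (sector a I T)"
      using lim by (intro Lim_in_closed_set[OF closed_closure]) auto
    then show "z \<in> closure (sector a I T)"
      by simp
  qed
qed

definition cone_chambers :: "('b \<Rightarrow> 'a::euclidean_space) \<Rightarrow> 'b set \<Rightarrow> 'a set set" where
  "cone_chambers a I = {closed_cell a I y | y. \<forall>i\<in>I. a i \<bullet> y \<noteq> 0}"

lemma closed_cell_face_of:
  assumes p: "p \<in> closed_cell a I y"
  shows "closed_cell a I p face_of closed_cell a I y"
  unfolding face_of_def
proof (intro conjI ballI impI)
  show "closed_cell a I p \<subseteq> closed_cell a I y"
    by (rule closed_cell_mono[OF p])
  show "convex (closed_cell a I p)"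
    by (rule convex_closed_cell)
  fix v w z assume vw: "v \<in> closed_cell a I y" "w \<in> closed_cell a I y"
    and z: "z \<in> closed_cell a I p" "z \<in> open_segment v w"
  obtain t where t: "0 < t" "t < 1" "z = (1 - t) *\<^sub>R v + t *\<^sub>R w"
    using z(2) by (auto simp: in_segment)
  have "(a i \<bullet> v = 0 \<or> sgn (a i \<bullet> v) = sgn (a i \<bullet> p)) \<and> (a i \<bullet> w = 0 \<or> sgn (a i \<bullet> w) = sgn (a i \<bullet> p))"
    if "i \<in> I" for i
  proof (cases "a i \<bullet> p = 0")
    case False
    then show ?thesis
      using p vw that by (fastforce simp: closed_cell_def)
  next
    case True
    then have "a i \<bullet> z = 0"
      using z(1) that by (auto simp: closed_cell_def sgn_0_0)
    then have eq: "(1 - t) * (a i \<bullet> v) + t * (a i \<bullet> w) = 0"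
      by (simp add: t inner_add_right)
    have "(a i \<bullet> v \<ge> 0 \<and> a i \<bullet> w \<ge> 0) \<or> (a i \<bullet> v \<le> 0 \<and> a i \<bullet> w \<le> 0)"
      using vw that by (fastforce simp: closed_cell_eq_halfspaces)
    then have "a i \<bullet> v = 0 \<and> a i \<bullet> w = 0"
    proof
      assume "a i \<bullet> v \<ge> 0 \<and> a i \<bullet> w \<ge> 0"
      then have "(1 - t) * (a i \<bullet> v) \<ge> 0" "t * (a i \<bullet> w) \<ge> 0"
        using t by simp_all
      with eq have "(1 - t) * (a i \<bullet> v) = 0" "t * (a i \<bullet> w) = 0"
        by linarith+
      with t show ?thesis by simp
    next
      assume "a i \<bullet> v \<le> 0 \<and> a i \<bullet> w \<le> 0"
      then have "(1 - t) * (a i \<bullet> v) \<le> 0" "t * (a i \<bullet> w) \<le> 0"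
        using t by (simp_all add: mult_nonneg_nonpos)
      with eq have "(1 - t) * (a i \<bullet> v) = 0" "t * (a i \<bullet> w) = 0"
        by linarith+
      with t show ?thesis by simp
    qed
    then show ?thesis by simp
  qed
  then show "v \<in> closed_cell a I p" "w \<in> closed_cell a I p"
    by (auto simp: closed_cell_def)
qed

text \<open>Take \<open>p\<close> in the relative interior of \<open>F\<close>. Points of \<open>F\<close> can be prolonged beyond \<open>p\<close> within
  \<open>F\<close>, which forces them to vanish wherever \<open>p\<close> does; conversely a point of the cell of
  \<open>p\<close> can be prolonged beyond \<open>p\<close> within the cell, so that it is an end of a segment having
  the point \<open>p\<close> of \<open>F\<close> inside.\<close>

lemma face_of_closed_cellE:
  assumes "finite I" and F: "F face_of closed_cell a I y" "F \<noteq> {}"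
  obtains p where "p \<in> closed_cell a I y" "F = closed_cell a I p"
proof -
  have cF: "convex F"
    using F(1) by (rule face_of_imp_convex)
  have sub: "F \<subseteq> closed_cell a I y"
    using F by (simp add: face_of_imp_subset)
  obtain p where p: "p \<in> rel_interior F"
    using cF F rel_interior_eq_empty by blast
  then have pF: "p \<in> F"
    using rel_interior_subset by blast
  have "F = closed_cell a I p"
  proof
    show "F \<subseteq> closed_cell a I p"
    proof
      fix z assume "z \<in> F"
      then obtain e where e: "e > 1" "(1 - e) *\<^sub>R z + e *\<^sub>R p \<in> F"
        using p cF F by (meson convex_rel_interior_iff)
      have "a i \<bullet> z = 0 \<or> sgn (a i \<bullet> z) = sgn (a i \<bullet> p)" if "i \<in> I" for i
      proof (cases "a i \<bullet> p = 0")
        case False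
        then show ?thesis
          using subsetD[OF sub \<open>z \<in> F\<close>] subsetD[OF sub pF] that
          unfolding closed_cell_def mem_Collect_eq by metis
      next
        case True
        have "a i \<bullet> ((1 - e) *\<^sub>R z + e *\<^sub>R p) = (1 - e) * (a i \<bullet> z)"
          using True by (simp add: inner_add_right)
        moreover have "(a i \<bullet> y \<le> 0 \<longrightarrow> a i \<bullet> v \<le> 0) \<and> (a i \<bullet> y \<ge> 0 \<longrightarrow> a i \<bullet> v \<ge> 0)" if "v \<in> F" for v
          using that sub \<open>i \<in> I\<close> by (auto simp: closed_cell_eq_halfspaces)
        ultimately have "(a i \<bullet> z \<ge> 0 \<and> (1 - e) * (a i \<bullet> z) \<ge> 0) \<or> (a i \<bullet> z \<le> 0 \<and> (1 - e) * (a i \<bullet> z) \<le> 0)"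
          using \<open>z \<in> F\<close> e(2) linear[of "a i \<bullet> y" 0] by metis
        then have "a i \<bullet> z = 0"
          using e(1) by (auto simp: zero_le_mult_iff mult_le_0_iff)
        then show ?thesis by simp
      qed
      then show "z \<in> closed_cell a I p"
        by (simp add: closed_cell_def)
    qed
    show "closed_cell a I p \<subseteq> F"
    proof
      fix z assume z: "z \<in> closed_cell a I p"
      obtain e where e: "e > 0" "\<And>i. i \<in> I \<Longrightarrow> a i \<bullet> p \<noteq> 0 \<Longrightarrow> sgn (a i \<bullet> (p + e *\<^sub>R (p - z))) = sgn (a i \<bullet> p)"
        by (rule sgn_preserving_prolongation[OF \<open>finite I\<close>, of a p "p - z"]) blast
      define v where "v = p + e *\<^sub>R (p - z)"
      have "v \<in> closed_cell a I p"
        unfolding closed_cell_def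
      proof (intro CollectI ballI)
        fix i assume "i \<in> I"
        show "a i \<bullet> v = 0 \<or> sgn (a i \<bullet> v) = sgn (a i \<bullet> p)"
        proof (cases "a i \<bullet> p = 0")
          case True
          then have "a i \<bullet> z = 0"
            using z \<open>i \<in> I\<close> by (auto simp: closed_cell_def sgn_0_0)
          with True show ?thesis
            by (simp add: v_def inner_add_right inner_diff_right)
        qed (use e \<open>i \<in> I\<close> in \<open>simp add: v_def\<close>)
      qed
      then have v: "v \<in> closed_cell a I y" and z': "z \<in> closed_cell a I y"
        using z pF sub closed_cell_mono by blast+
      show "z \<in> F"
      proof (cases "z = p")
        case False
        have "p = (1 - 1 / (1 + e)) *\<^sub>R z + (1 / (1 + e)) *\<^sub>R v"
        proof -
          have "(1 + e) *\<^sub>R p = e *\<^sub>R z + v"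
            by (simp add: v_def algebra_simps)
          then have "p = (1 / (1 + e)) *\<^sub>R (e *\<^sub>R z + v)"
            using e(1) by (metis add_pos_pos divide_inverse less_numeral_extra(1,3) mult_1 real_vector.scale_one scaleR_scaleR left_inverse)
          moreover have "1 - 1 / (1 + e) = (1 / (1 + e)) * e"
            using e(1) by (simp add: field_simps)
          ultimately show ?thesis
            by (simp add: scaleR_add_right)
        qed
        moreover have "z \<noteq> v"
        proof
          assume "z = v"
          then have "(1 + e) *\<^sub>R (p - z) = 0"
            by (simp add: v_def algebra_simps)
          with e(1) False show False by simp
        qed
        moreover have "0 < 1 / (1 + e)" "1 / (1 + e) < 1"
          using e(1) by simp_all
        ultimately have "p \<in> open_segment z v"
          unfolding in_segment by blast
        then show ?thesis
          using face_ofD[OF F(1) _ z' v pF] by blast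
      qed (use pF in simp)
    qed
  qed
  with that pF sub show thesis
    by blast
qed

text \<open>From \<open>p\<close> one can move a little within the cell towards any point of the flat, so that this point is
  on a line through two points of the cell.\<close>

lemma affine_hull_closed_cell:
  assumes "finite I"
  shows "affine hull closed_cell a I p = flat_of a (zeros a I p)"
proof
  have "affine (flat_of a (zeros a I p))"
    by (simp add: subspace_flat_of subspace_imp_affine)
  then show "affine hull closed_cell a I p \<subseteq> flat_of a (zeros a I p)"
    by (intro hull_minimal) (auto simp: closed_cell_def flat_of_def zeros_def sgn_0_0)
  show "flat_of a (zeros a I p) \<subseteq> affine hull closed_cell a I p"
  proof
    fix z assume z: "z \<in> flat_of a (zeros a I p)"
    obtain e where e: "e > 0" "\<And>i. i \<in> I \<Longrightarrow> a i \<bullet> p \<noteq> 0 \<Longrightarrow> sgn (a i \<bullet> (p + e *\<^sub>R (z - p))) = sgn (a i \<bullet> p)"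
      by (rule sgn_preserving_prolongation[OF assms, of a p "z - p"]) blast
    define v where "v = p + e *\<^sub>R (z - p)"
    have "a i \<bullet> v = 0 \<or> sgn (a i \<bullet> v) = sgn (a i \<bullet> p)" if "i \<in> I" for i
      using that z e by (cases "a i \<bullet> p = 0") (auto simp: v_def flat_of_def zeros_def inner_add_right inner_diff_right)
    then have "v \<in> closed_cell a I p"
      by (simp add: closed_cell_def)
    then have v: "v \<in> affine hull closed_cell a I p"
      by (rule hull_inc)
    have p: "p \<in> affine hull closed_cell a I p"
      by (intro hull_inc self_in_closed_cell)
    have "z = (1 - 1 / e) *\<^sub>R p + (1 / e) *\<^sub>R v"
      using e(1) by (simp add: v_def algebra_simps)
    also have "\<dots> \<in> affine hull closed_cell a I p"
      using v p by (intro mem_affine) auto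
    finally show "z \<in> affine hull closed_cell a I p" .
  qed
qed

lemma aff_dim_closed_cell:
  assumes "finite I"
  shows "aff_dim (closed_cell a I p) = int (dim (flat_of a (zeros a I p)))"
proof -
  have "aff_dim (closed_cell a I p) = aff_dim (affine hull closed_cell a I p)"
    by (rule aff_dim_affine_hull[symmetric])
  also have "\<dots> = int (dim (flat_of a (zeros a I p)))"
    unfolding affine_hull_closed_cell[OF assms] by (rule aff_dim_subspace[OF subspace_flat_of])
  finally show ?thesis .
qed

text \<open>A normal vector of the face \<open>F\<close> vanishes on \<open>F\<close>, because \<open>F\<close> contains the origin, and hence on
  its span \<open>L\<close>. A decomposition of \<open>q + u\<close> into a point of \<open>F\<close> and a normal vector is
  therefore the orthogonal decomposition along \<open>L\<close>.\<close>

lemma mem_face_normal_sum_iff: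
  fixes a :: "'b \<Rightarrow> 'a::euclidean_space"
  assumes "finite I" and L: "L = flat_of a (zeros a I p)" and p: "p \<in> closed_cell a I y"
    and q: "q \<in> L" and u: "\<And>w. w \<in> L \<Longrightarrow> u \<bullet> w = 0"
  shows "q + u \<in> face_normal_sum (closed_cell a I p) (closed_cell a I y)
     \<longleftrightarrow> q \<in> closed_cell a I p \<and> (\<forall>z\<in>closed_cell a I y. u \<bullet> z \<le> 0)"
proof
  have hull: "affine hull closed_cell a I p = L"
    unfolding L by (rule affine_hull_closed_cell[OF \<open>finite I\<close>])
  have FL: "closed_cell a I p \<subseteq> L"
    using hull_subset[of "closed_cell a I p" affine] unfolding hull .
  assume "q + u \<in> face_normal_sum (closed_cell a I p) (closed_cell a I y)"
  then obtain f c where fc: "q + u = f + c" "f \<in> closed_cell a I p" "c \<in> normal_cone (closed_cell a I p) (closed_cell a I y)"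
    unfolding face_normal_sum_def set_plus_def by blast
  have c: "c \<bullet> z \<le> c \<bullet> w" if "z \<in> closed_cell a I y" "w \<in> closed_cell a I p" for z w
    using fc(3) that by (simp add: normal_cone_def)
  have c_le: "c \<bullet> z \<le> 0" if "z \<in> closed_cell a I y" for z
    using c[OF that zero_in_closed_cell] by simp
  have "c \<bullet> w = 0" if "w \<in> closed_cell a I p" for w
    using c[OF zero_in_closed_cell that] c_le closed_cell_mono[OF p] that by fastforce
  then have "affine hull closed_cell a I p \<subseteq> {w. c \<bullet> w = 0}"
    by (intro hull_minimal) (auto simp: affine_hyperplane)
  then have c0: "c \<bullet> w = 0" if "w \<in> L" for w
    using hull that by blast
  have "q - f \<in> L"
    using q fc(2) FL unfolding L by (auto intro: subspace_diff[OF subspace_flat_of])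
  moreover have "q - f = c - u"
    using fc(1) by (simp add: algebra_simps)
  ultimately have "(q - f) \<bullet> (q - f) = 0"
    using c0[of "q - f"] u[of "q - f"] by (simp add: inner_diff_left)
  then have "q = f" "u = c"
    using \<open>q - f = c - u\<close> by auto
  with fc(2) c_le show "q \<in> closed_cell a I p \<and> (\<forall>z\<in>closed_cell a I y. u \<bullet> z \<le> 0)"
    by blast
next
  assume *: "q \<in> closed_cell a I p \<and> (\<forall>z\<in>closed_cell a I y. u \<bullet> z \<le> 0)"
  have "closed_cell a I p \<subseteq> L"
    using hull_subset[of "closed_cell a I p" affine]
    unfolding L affine_hull_closed_cell[OF \<open>finite I\<close>] .
  then have "u \<bullet> w = 0" if "w \<in> closed_cell a I p" for w
    using that u by blast
  then have "u \<in> normal_cone (closed_cell a I p) (closed_cell a I y)"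
    using * by (simp add: normal_cone_def)
  then show "q + u \<in> face_normal_sum (closed_cell a I p) (closed_cell a I y)"
    unfolding face_normal_sum_def using * by (intro set_plus_intro) simp_all
qed

section \<open>Counting chambers and cells around a flat\<close>

text \<open>The chambers having the cell of \<open>p\<close> as a face are those of the localization, consisting of the
  hyperplanes through \<open>p\<close>: all other signs are dictated by \<open>p\<close>, and conversely \<open>p + e y\<close> realizes
  the signs of \<open>p\<close> together with the localized signs of \<open>y\<close>. Since \<open>u\<close> is zero at \<open>p\<close>, it is
  nonpositive on the chamber as soon as it is so on the directions \<open>y\<close>.\<close>

lemma card_chambers_below:
  fixes a :: "'b \<Rightarrow> 'a::euclidean_space"
  assumes fin: "finite I" and u: "\<And>w. w \<in> flat_of a (zeros a I p) \<Longrightarrow> u \<bullet> w = 0"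
  shows "card {C \<in> cone_chambers a I. p \<in> C \<and> (\<forall>z\<in>C. u \<bullet> z \<le> 0)}
       = card (sectors_below a (zeros a I p) UNIV u)"
proof -
  define Z where "Z = zeros a I p"
  define P where "P = {i\<in>I. a i \<bullet> p > 0}"
  define h where "h T = closure (sector a I (T \<union> P))" for T
  have up: "u \<bullet> p = 0"
    using u[of p] by (auto simp: flat_of_def zeros_def)
  have ZP: "Z \<inter> P = {}" "Z \<subseteq> I" and finZ: "finite Z"
    using fin by (auto simp: Z_def P_def zeros_def)
  have sub: "sector a I (T \<union> P) \<subseteq> sector a Z T" for T
    using ZP by (fastforce simp: sector_def split: if_splits)
  have push: "\<exists>e>0. p + e *\<^sub>R y \<in> sector a I (T \<union> P)" if y: "y \<in> sector a Z T" and "T \<subseteq> Z" for T y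
  proof -
    obtain e where e: "e > 0" "\<And>i. i \<in> I \<Longrightarrow> a i \<bullet> p \<noteq> 0 \<Longrightarrow> sgn (a i \<bullet> (p + e *\<^sub>R y)) = sgn (a i \<bullet> p)"
      by (rule sgn_preserving_prolongation[OF fin, of a p y]) blast
    have "sgn (a i \<bullet> (p + e *\<^sub>R y)) = (if i \<in> T \<union> P then 1 else - 1)" if "i \<in> I" for i
    proof (cases "i \<in> Z")
      case True
      then have "sgn (a i \<bullet> y) = (if i \<in> T then 1 else - 1)" "a i \<bullet> p = 0"
        using y by (auto simp: mem_sector_iff_sgn Z_def zeros_def)
      moreover have "i \<notin> P"
        using True ZP by blast
      ultimately show ?thesis
        using e(1) by (simp add: inner_add_right sgn_mult)
    next
      case False
      then have "a i \<bullet> p \<noteq> 0" "i \<notin> T"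
        using \<open>i \<in> I\<close> \<open>T \<subseteq> Z\<close> by (auto simp: Z_def zeros_def)
      then show ?thesis
        using e(2)[OF \<open>i \<in> I\<close>] \<open>i \<in> I\<close> by (auto simp: P_def sgn_if)
    qed
    then show ?thesis
      using e(1) mem_sector_iff_sgn by blast
  qed
  have le_iff: "(\<forall>z\<in>closure (sector a I (T \<union> P)). u \<bullet> z \<le> 0) \<longleftrightarrow> (\<forall>y\<in>sector a Z T. u \<bullet> y \<le> 0)"
    if TZ: "T \<subseteq> Z" for T
  proof
    assume *: "\<forall>z\<in>closure (sector a I (T \<union> P)). u \<bullet> z \<le> 0"
    show "\<forall>y\<in>sector a Z T. u \<bullet> y \<le> 0"
    proof
      fix y assume "y \<in> sector a Z T"
      then obtain e where e: "e > 0" "p + e *\<^sub>R y \<in> sector a I (T \<union> P)"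
        using push TZ by blast
      then have "u \<bullet> (p + e *\<^sub>R y) \<le> 0"
        using * closure_subset by blast
      then show "u \<bullet> y \<le> 0"
        using up e(1) by (simp add: inner_add_right mult_le_0_iff)
    qed
  next
    assume "\<forall>y\<in>sector a Z T. u \<bullet> y \<le> 0"
    then have "sector a I (T \<union> P) \<subseteq> {z. u \<bullet> z \<le> 0}"
      using sub by blast
    then have "closure (sector a I (T \<union> P)) \<subseteq> {z. u \<bullet> z \<le> 0}"
      by (intro closure_minimal) (auto simp: closed_halfspace_le)
    then show "\<forall>z\<in>closure (sector a I (T \<union> P)). u \<bullet> z \<le> 0"
      by blast
  qed
  have "bij_betw h (sectors_below a Z UNIV u)
      {C \<in> cone_chambers a I. p \<in> C \<and> (\<forall>z\<in>C. u \<bullet> z \<le> 0)}"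
    unfolding bij_betw_def
  proof (intro conjI inj_onI)
    fix T1 T2 assume T: "T1 \<in> sectors_below a Z UNIV u" "T2 \<in> sectors_below a Z UNIV u" "h T1 = h T2"
    then have TZ: "T1 \<subseteq> Z" "T2 \<subseteq> Z"
      by (auto simp: sectors_below_def)
    have "sector a Z T1 \<noteq> {}" "sector a Z T2 \<noteq> {}"
      using T by (auto simp: sectors_below_def below_def)
    then obtain y1 y2 where y: "y1 \<in> sector a I (T1 \<union> P)" "y2 \<in> sector a I (T2 \<union> P)"
      using push[OF _ TZ(1)] push[OF _ TZ(2)] by blast
    then have "closed_cell a I y1 = closed_cell a I y2"
      using T(3) by (simp add: h_def closure_sector)
    then have "sgn (a i \<bullet> y1) = sgn (a i \<bullet> y2)" if "i \<in> I" for i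
      using that by (simp add: closed_cell_eq_iff)
    with y have "i \<in> T1 \<union> P \<longleftrightarrow> i \<in> T2 \<union> P" if "i \<in> I" for i
      using that unfolding mem_sector_iff_sgn by (metis one_neq_neg_one)
    then show "T1 = T2"
      using TZ ZP by blast
  next
    show "h ` sectors_below a Z UNIV u = {C \<in> cone_chambers a I. p \<in> C \<and> (\<forall>z\<in>C. u \<bullet> z \<le> 0)}"
    proof (intro equalityI subsetI)
      fix C assume "C \<in> h ` sectors_below a Z UNIV u"
      then obtain T where T: "T \<subseteq> Z" "sector a Z T \<noteq> {}" "\<forall>y\<in>sector a Z T. u \<bullet> y \<le> 0" and C: "C = h T"
        by (auto simp: sectors_below_def below_def)
      obtain y0 where y0: "y0 \<in> sector a Z T"
        using T by blast
      then obtain y where y: "y \<in> sector a I (T \<union> P)"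
        using push T by blast
      have Cy: "C = closed_cell a I y"
        using C closure_sector[OF y] by (simp add: h_def)
      moreover have "\<forall>i\<in>I. a i \<bullet> y \<noteq> 0"
        using sector_nonzero[OF y] by blast
      ultimately have "C \<in> cone_chambers a I"
        by (auto simp: cone_chambers_def)
      moreover have "p \<in> C"
        unfolding Cy closed_cell_def
      proof (intro CollectI ballI)
        fix i assume i: "i \<in> I"
        have "i \<notin> T" if "a i \<bullet> p \<noteq> 0"
          using that T(1) by (auto simp: Z_def zeros_def)
        then show "a i \<bullet> p = 0 \<or> sgn (a i \<bullet> p) = sgn (a i \<bullet> y)"
          using y i by (auto simp: mem_sector_iff_sgn P_def sgn_if)
      qed
      ultimately show "C \<in> {C \<in> cone_chambers a I. p \<in> C \<and> (\<forall>z\<in>C. u \<bullet> z \<le> 0)}"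
        using le_iff[OF T(1)] T(3) C by (simp add: h_def)
    next
      fix C assume "C \<in> {C \<in> cone_chambers a I. p \<in> C \<and> (\<forall>z\<in>C. u \<bullet> z \<le> 0)}"
      then obtain y where y: "\<forall>i\<in>I. a i \<bullet> y \<noteq> 0" "C = closed_cell a I y" "p \<in> C" "\<forall>z\<in>C. u \<bullet> z \<le> 0"
        by (auto simp: cone_chambers_def)
      define T where "T = {i\<in>Z. a i \<bullet> y > 0}"
      have "T \<subseteq> Z"
        by (auto simp: T_def)
      have yT: "y \<in> sector a I (T \<union> P)"
        unfolding mem_sector_iff_sgn
      proof
        fix i assume i: "i \<in> I"
        show "sgn (a i \<bullet> y) = (if i \<in> T \<union> P then 1 else - 1)"
        proof (cases "i \<in> Z")
          case True
          then show ?thesis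
            using y(1) i ZP by (auto simp: T_def sgn_if)
        next
          case False
          then have "sgn (a i \<bullet> p) = sgn (a i \<bullet> y)"
            using y(2,3) i by (auto simp: closed_cell_def Z_def zeros_def)
          then show ?thesis
            using False i y(1) by (auto simp: T_def P_def sgn_if split: if_splits)
        qed
      qed
      have "C = h T"
        unfolding h_def closure_sector[OF yT] by (rule y(2))
      moreover have "T \<in> sectors_below a Z UNIV u"
        using \<open>T \<subseteq> Z\<close> subsetD[OF sub yT] le_iff[of T] y(4) \<open>C = h T\<close>
        by (auto simp: sectors_below_def below_def h_def)
      ultimately show "C \<in> h ` sectors_below a Z UNIV u"
        by blast
    qed
  qed
  then show ?thesis
    unfolding Z_def by (intro bij_betw_same_card[symmetric])
qed

text \<open>A subspace is not the union of finitely many proper subspaces: moving off one more hyperplane by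
  a small enough step does not run into those already avoided.\<close>

lemma exists_generic_point:
  fixes a :: "'b \<Rightarrow> 'a::euclidean_space"
  assumes "finite I" "subspace L"
  shows "\<exists>w\<in>L. \<forall>i\<in>I. \<not> L \<subseteq> flat_of a {i} \<longrightarrow> a i \<bullet> w \<noteq> 0"
  using assms(1)
proof (induction I rule: finite_induct)
  case empty
  then show ?case
    using subspace_0[OF assms(2)] by blast
next
  case (insert i I)
  then obtain w where w: "w \<in> L" "\<forall>j\<in>I. \<not> L \<subseteq> flat_of a {j} \<longrightarrow> a j \<bullet> w \<noteq> 0"
    by blast
  show ?case
  proof (cases "L \<subseteq> flat_of a {i} \<or> a i \<bullet> w \<noteq> 0")
    case False
    then obtain v where v: "v \<in> L" "a i \<bullet> v \<noteq> 0" and iw: "a i \<bullet> w = 0"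
      by (auto simp: flat_of_def)
    obtain e where e: "e > 0" "\<And>j. j \<in> I \<Longrightarrow> a j \<bullet> w \<noteq> 0 \<Longrightarrow> sgn (a j \<bullet> (w + e *\<^sub>R v)) = sgn (a j \<bullet> w)"
      by (rule sgn_preserving_prolongation[OF \<open>finite I\<close>, of a w v]) blast
    have "a j \<bullet> (w + e *\<^sub>R v) \<noteq> 0" if "j \<in> I" "\<not> L \<subseteq> flat_of a {j}" for j
      using e(2)[of j] w that by (metis sgn_0_0)
    moreover have "a i \<bullet> (w + e *\<^sub>R v) \<noteq> 0"
      using v iw e(1) by (simp add: inner_add_right)
    moreover have "w + e *\<^sub>R v \<in> L"
      using w v assms by (intro subspace_add subspace_scale)
    ultimately show ?thesis
      by blast
  qed (use w in blast)
qed

text \<open>The chambers that contain \<open>q\<close> of the restriction to \<open>L\<close>, seen as closed cells of the whole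
  arrangement.\<close>

definition cells_over :: "('b \<Rightarrow> 'a::euclidean_space) \<Rightarrow> 'b set \<Rightarrow> 'a set \<Rightarrow> 'a \<Rightarrow> 'a set set" where
  "cells_over a I L q = {closed_cell a I p | p. flat_of a (zeros a I p) = L \<and> q \<in> closed_cell a I p}"

lemma finite_closed_cells:
  assumes "finite I"
  shows "finite (range (closed_cell a I))"
proof -
  \<comment> \<open>a cell is determined by the sets of indices with zero and with positive sign\<close>
  have "closed_cell a I p \<in> (\<lambda>(Z, P). {z. \<forall>i\<in>I. a i \<bullet> z = 0 \<or> sgn (a i \<bullet> z) = (if i \<in> Z then 0 else if i \<in> P then 1 else - 1)}) ` (Pow I \<times> Pow I)" for p
  proof
    show "({i\<in>I. a i \<bullet> p = 0}, {i\<in>I. a i \<bullet> p > 0}) \<in> Pow I \<times> Pow I"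
      by auto
    show "closed_cell a I p = (\<lambda>(Z, P). {z. \<forall>i\<in>I. a i \<bullet> z = 0 \<or> sgn (a i \<bullet> z) = (if i \<in> Z then 0 else if i \<in> P then 1 else - 1)})
        ({i\<in>I. a i \<bullet> p = 0}, {i\<in>I. a i \<bullet> p > 0})"
      by (auto simp: closed_cell_def sgn_if)
  qed
  then show ?thesis
    using assms by (meson finite_Pow_iff finite_SigmaI finite_imageI finite_subset image_subsetI)
qed

lemma finite_cells_over: "finite I \<Longrightarrow> finite (cells_over a I L q)"
  by (rule finite_subset[OF _ finite_closed_cells]) (auto simp: cells_over_def)

text \<open>Moving from \<open>q\<close> by a small generic vector \<open>w\<close> of \<open>L\<close>, forwards or backwards, leads into the
  interior of a chamber of the restriction whose closure contains \<open>q\<close>. The assumption on \<open>L\<close>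
  says that \<open>L\<close> is a flat.\<close>

lemma cells_over_nearby:
  fixes a :: "'b \<Rightarrow> 'a::euclidean_space"
  assumes fin: "finite I" and L: "L = flat_of a {i\<in>I. L \<subseteq> flat_of a {i}}" and q: "q \<in> L"
  obtains w e where "e > 0"
    "\<And>i. i \<in> I \<Longrightarrow> \<not> L \<subseteq> flat_of a {i} \<Longrightarrow> a i \<bullet> w \<noteq> 0"
    "closed_cell a I (q + e *\<^sub>R w) \<in> cells_over a I L q"
    "closed_cell a I (q - e *\<^sub>R w) \<in> cells_over a I L q"
proof -
  have sL: "subspace L"
    using L subspace_flat_of by metis
  obtain w where w: "w \<in> L" "\<And>i. i \<in> I \<Longrightarrow> \<not> L \<subseteq> flat_of a {i} \<Longrightarrow> a i \<bullet> w \<noteq> 0"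
    using exists_generic_point[OF fin sL] by blast
  obtain e where e: "e > 0"
    "\<And>i. i \<in> I \<Longrightarrow> a i \<bullet> q \<noteq> 0 \<Longrightarrow> sgn (a i \<bullet> (q + e *\<^sub>R w)) = sgn (a i \<bullet> q)"
    "\<And>i. i \<in> I \<Longrightarrow> a i \<bullet> q \<noteq> 0 \<Longrightarrow> sgn (a i \<bullet> (q - e *\<^sub>R w)) = sgn (a i \<bullet> q)"
    by (rule sgn_preserving_prolongation[OF fin, of a q w]) blast
  have *: "closed_cell a I r \<in> cells_over a I L q"
    if r: "r \<in> L" "\<And>i. i \<in> I \<Longrightarrow> a i \<bullet> q \<noteq> 0 \<Longrightarrow> sgn (a i \<bullet> r) = sgn (a i \<bullet> q)"
      "\<And>i. i \<in> I \<Longrightarrow> a i \<bullet> q = 0 \<Longrightarrow> a i \<bullet> w \<noteq> 0 \<Longrightarrow> a i \<bullet> r \<noteq> 0" for r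
  proof -
    have "a i \<bullet> r = 0 \<longleftrightarrow> L \<subseteq> flat_of a {i}" if "i \<in> I" for i
    proof
      assume "a i \<bullet> r = 0"
      then have "a i \<bullet> q = 0"
        using r(2)[OF that] by (metis sgn_0_0)
      with r(3)[OF that] w(2)[OF that] \<open>a i \<bullet> r = 0\<close> show "L \<subseteq> flat_of a {i}"
        by blast
    qed (use r in \<open>auto simp: flat_of_def\<close>)
    then have "zeros a I r = {i\<in>I. L \<subseteq> flat_of a {i}}"
      by (auto simp: zeros_def)
    then have "flat_of a (zeros a I r) = L"
      using L by simp
    moreover have "q \<in> closed_cell a I r"
      using r(2) by (force simp: closed_cell_def)
    ultimately show ?thesis
      by (auto simp: cells_over_def)
  qed
  have "closed_cell a I (q + e *\<^sub>R w) \<in> cells_over a I L q"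
    using e w q sL by (intro *) (auto intro: subspace_add subspace_scale simp: inner_add_right)
  moreover have "closed_cell a I (q - e *\<^sub>R w) \<in> cells_over a I L q"
    using e w q sL by (intro *) (auto intro: subspace_diff subspace_scale simp: inner_diff_right)
  ultimately show thesis
    using that e(1) w(2) by blast
qed

lemma card_cells_over_ge_1:
  assumes "finite I" "L = flat_of a {i\<in>I. L \<subseteq> flat_of a {i}}" "q \<in> L"
  shows "card (cells_over a I L q) \<ge> 1"
proof -
  have "cells_over a I L q \<noteq> {}"
    by (rule cells_over_nearby[OF assms]) blast
  then show ?thesis
    using finite_cells_over[OF assms(1), of a L q] by (metis One_nat_def Suc_leI card_gt_0_iff)
qed

text \<open>The two cells reached by moving forwards and backwards lie on different sides of the hyperplane
  of \<open>i\<close>.\<close>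

lemma card_cells_over_ge_2:
  assumes "finite I" "L = flat_of a {i\<in>I. L \<subseteq> flat_of a {i}}" "q \<in> L"
    and i: "i \<in> I" "\<not> L \<subseteq> flat_of a {i}" "a i \<bullet> q = 0"
  shows "card (cells_over a I L q) \<ge> 2"
proof -
  obtain w e where e: "e > 0" "a i \<bullet> w \<noteq> 0"
    and mem: "closed_cell a I (q + e *\<^sub>R w) \<in> cells_over a I L q" "closed_cell a I (q - e *\<^sub>R w) \<in> cells_over a I L q"
    by (rule cells_over_nearby[OF assms(1-3)]) (use i in blast)
  have "sgn (a i \<bullet> (q + e *\<^sub>R w)) \<noteq> sgn (a i \<bullet> (q - e *\<^sub>R w))"
    using e i by (auto simp: inner_add_right inner_diff_right sgn_if mult_less_0_iff zero_less_mult_iff)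
  then have "closed_cell a I (q + e *\<^sub>R w) \<noteq> closed_cell a I (q - e *\<^sub>R w)"
    using i by (auto simp: closed_cell_eq_iff)
  then have "card {closed_cell a I (q + e *\<^sub>R w), closed_cell a I (q - e *\<^sub>R w)} = 2"
    by simp
  moreover have "card {closed_cell a I (q + e *\<^sub>R w), closed_cell a I (q - e *\<^sub>R w)} \<le> card (cells_over a I L q)"
    using mem by (intro card_mono finite_cells_over assms) auto
  ultimately show ?thesis
    by linarith
qed

lemma card_cells_over_eq_1:
  assumes "finite I" "L = flat_of a {i\<in>I. L \<subseteq> flat_of a {i}}" "q \<in> L"
    and nz: "\<And>i. i \<in> I \<Longrightarrow> \<not> L \<subseteq> flat_of a {i} \<Longrightarrow> a i \<bullet> q \<noteq> 0"
  shows "card (cells_over a I L q) = 1"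
proof -
  have "cells_over a I L q \<subseteq> {closed_cell a I q}"
  proof
    fix F assume "F \<in> cells_over a I L q"
    then obtain p where p: "F = closed_cell a I p" "flat_of a (zeros a I p) = L" "q \<in> closed_cell a I p"
      by (auto simp: cells_over_def)
    have "sgn (a i \<bullet> p) = sgn (a i \<bullet> q)" if "i \<in> I" for i
    proof (cases "L \<subseteq> flat_of a {i}")
      case True
      have "p \<in> L"
        using p(2) by (auto simp: flat_of_def zeros_def)
      with True assms(3) have "a i \<bullet> p = 0" "a i \<bullet> q = 0"
        by (auto simp: flat_of_def)
      then show ?thesis by simp
    next
      case False
      then show ?thesis
        using nz[OF that False] p(3) that by (auto simp: closed_cell_def)
    qed
    then show "F \<in> {closed_cell a I q}"
      by (simp add: p(1) closed_cell_eq_iff)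
  qed
  then have "card (cells_over a I L q) \<le> 1"
    using card_mono[of "{closed_cell a I q}"] by simp
  then show ?thesis
    using card_cells_over_ge_1[OF assms(1-3)] by linarith
qed

section \<open>Chambers and flats of an arrangement\<close>

definition normal :: "'a::euclidean_space set \<Rightarrow> 'a" where
  "normal H = (SOME a. a \<noteq> 0 \<and> H = {x. a \<bullet> x = 0})"

lemma normal:
  assumes "arrangement A" "H \<in> A"
  shows "normal H \<noteq> 0" and "flat_of normal {H} = H"
proof -
  have "\<exists>a. a \<noteq> 0 \<and> H = {x. a \<bullet> x = 0}"
    using assms by (auto simp: arrangement_def linear_hyperplane_def)
  then have "normal H \<noteq> 0 \<and> H = {x. normal H \<bullet> x = 0}"
    unfolding normal_def by (rule someI_ex)
  then show "normal H \<noteq> 0" "flat_of normal {H} = H"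
    by (auto simp: flat_of_def)
qed

lemma normal_inner_eq_0_iff:
  assumes "arrangement A" "H \<in> A"
  shows "normal H \<bullet> x = 0 \<longleftrightarrow> x \<in> H"
  using normal(2)[OF assms] by (auto simp: flat_of_def)

lemma flat_of_normal:
  assumes "arrangement A" "S \<subseteq> A"
  shows "flat_of normal S = \<Inter>S"
proof -
  have "normal H \<bullet> x = 0 \<longleftrightarrow> x \<in> H" if "H \<in> S" for H x
    using normal_inner_eq_0_iff[OF assms(1)] assms(2) that by blast
  then show ?thesis
    by (simp add: flat_of_def set_eq_iff)
qed

lemma subspace_flat:
  assumes "arrangement A" "L \<in> flats A"
  shows "subspace L"
proof -
  obtain B where "B \<subseteq> A" "L = \<Inter>B"
    using assms(2) by (auto simp: flats_def)
  then show ?thesis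
    using subspace_flat_of[of normal B] flat_of_normal[OF assms(1)] by simp
qed

lemma flat_eq_Inter:
  assumes "L \<in> flats A"
  shows "L = \<Inter>{H\<in>A. L \<subseteq> H}"
  using assms by (auto simp: flats_def)

lemma finite_flats: "finite A \<Longrightarrow> finite (flats A)"
  by (rule finite_subset[of _ "Inter ` Pow A"]) (auto simp: flats_def)

lemma zeros_normal:
  assumes "arrangement A"
  shows "zeros normal A p = {H\<in>A. p \<in> H}"
  using normal_inner_eq_0_iff[OF assms] by (auto simp: zeros_def)

lemma flat_of_zeros_in_flats:
  assumes "arrangement A"
  shows "flat_of normal (zeros normal A p) \<in> flats A"
proof -
  have "zeros normal A p \<subseteq> A"
    by (auto simp: zeros_def)
  then show ?thesis
    using flat_of_normal[OF assms] by (auto simp: flats_def)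
qed

lemma zeros_eq_containing:
  assumes "arrangement A" "flat_of normal (zeros normal A p) = L"
  shows "zeros normal A p = {H\<in>A. L \<subseteq> H}"
proof -
  have "zeros normal A p \<subseteq> A"
    by (auto simp: zeros_def)
  then have "L = \<Inter>(zeros normal A p)"
    using flat_of_normal[OF assms(1)] assms(2) by simp
  then show ?thesis
    unfolding zeros_normal[OF assms(1)] by auto
qed

text \<open>Sectors are convex, hence connected, and a connected set avoiding a hyperplane stays on one side
  of it; so the components of the complement are the nonempty sectors.\<close>

lemma chambers_eq_cone_chambers:
  fixes A :: "'a::euclidean_space set set"
  assumes A: "arrangement A"
  shows "chambers A = cone_chambers normal A"
proof -
  have comp: "closure (connected_component_set (UNIV - \<Union>A) y) = closed_cell normal A y"
    if y: "y \<in> UNIV - \<Union>A" for y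
  proof -
    define T where "T = {H\<in>A. normal H \<bullet> y > 0}"
    have nz: "normal H \<bullet> y \<noteq> 0" if "H \<in> A" for H
      using that y normal_inner_eq_0_iff[OF A that] by blast
    then have yT: "y \<in> sector normal A T"
      unfolding T_def by (rule mem_own_sector)
    have "sector normal A T \<subseteq> UNIV - \<Union>A"
    proof
      fix z assume "z \<in> sector normal A T"
      then show "z \<in> UNIV - \<Union>A"
        using sector_nonzero[of z normal A T] normal_inner_eq_0_iff[OF A] by auto
    qed
    then have "sector normal A T \<subseteq> connected_component_set (UNIV - \<Union>A) y"
      using yT by (intro connected_component_maximal convex_connected convex_sector)
    moreover have "connected_component_set (UNIV - \<Union>A) y \<subseteq> sector normal A T"
    proof
      fix z assume "z \<in> connected_component_set (UNIV - \<Union>A) y"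
      then obtain K where K: "connected K" "K \<subseteq> UNIV - \<Union>A" "y \<in> K" "z \<in> K"
        by (auto simp: connected_component_def)
      have avoid: "normal H \<bullet> w \<noteq> 0" if "H \<in> A" "w \<in> K" for H w
        using that K(2) normal_inner_eq_0_iff[OF A, of H w] by blast
      have "if H \<in> T then normal H \<bullet> z > 0 else normal H \<bullet> z < 0" if H: "H \<in> A" for H
      proof (rule ccontr)
        assume "\<not> ?thesis"
        then have "(normal H \<bullet> y \<le> 0 \<and> 0 \<le> normal H \<bullet> z) \<or> (normal H \<bullet> z \<le> 0 \<and> 0 \<le> normal H \<bullet> y)"
          using H by (auto simp: T_def split: if_splits)
        then have "\<exists>w\<in>K. normal H \<bullet> w = 0"
          using connected_ivt_hyperplane[OF K(1) K(3) K(4)] connected_ivt_hyperplane[OF K(1) K(4) K(3)] by blast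
        with avoid H show False by blast
      qed
      then show "z \<in> sector normal A T"
        by (simp add: sector_def)
    qed
    ultimately have "connected_component_set (UNIV - \<Union>A) y = sector normal A T"
      by blast
    then show ?thesis
      using closure_sector[OF yT] by simp
  qed
  have "chambers A = (\<lambda>y. closed_cell normal A y) ` (UNIV - \<Union>A)"
    unfolding chambers_def components_def image_image by (intro image_cong refl comp)
  also have "\<dots> = cone_chambers normal A"
  proof -
    have "y \<in> UNIV - \<Union>A \<longleftrightarrow> (\<forall>H\<in>A. normal H \<bullet> y \<noteq> 0)" for y
      using normal_inner_eq_0_iff[OF A] by auto
    then show ?thesis
      unfolding cone_chambers_def by blast
  qed
  finally show ?thesis .
qed

lemma sum_alternating_Pow:
  assumes "finite I" "I \<noteq> {}"
  shows "(\<Sum>S\<in>Pow I. (- 1) ^ card S :: int) = 0"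
proof -
  obtain i J where I: "I = insert i J" "i \<notin> J"
    using assms(2) by (meson all_not_in_conv mk_disjoint_insert)
  then have J: "finite J"
    using assms(1) by simp
  have "(- 1) ^ card (insert i S) = - ((- 1) ^ card S :: int)" if "S \<in> Pow J" for S
  proof -
    have "finite S" "i \<notin> S"
      using that I J by (auto intro: finite_subset)
    then show ?thesis by simp
  qed
  then have "(\<Sum>S\<in>Pow J. (- 1) ^ card (insert i S) :: int) = (\<Sum>S\<in>Pow J. - ((- 1) ^ card S))"
    by (intro sum.cong) auto
  then show ?thesis
    unfolding I(1) sum_Pow_insert[OF J I(2)] by (simp add: sum_negf)
qed

text \<open>The cross-cut theorem for the lattice of flats. The alternating sums satisfy the defining
  recursion: summed over all flats containing \<open>L\<close> they give the alternating sum over all sets of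
  hyperplanes containing \<open>L\<close>, which vanishes unless there are none.\<close>

lemma moebius_flats_eq_alternating_sum:
  assumes fin: "finite A" and proper: "UNIV \<notin> A" and L: "L \<in> flats A"
  shows "moebius (flats A) UNIV L = (\<Sum>S\<in>Pow A. of_bool (\<Inter>S = L) * (- 1) ^ card S)"
  using L
proof (induction "card {Z\<in>flats A. L \<subset> Z}" arbitrary: L rule: less_induct)
  case less
  define f :: "'a set \<Rightarrow> int" where "f Z = (\<Sum>S\<in>Pow A. of_bool (\<Inter>S = Z) * (- 1) ^ card S)" for Z
  show ?case
  proof (cases "L = UNIV")
    case True
    have *: "\<Inter>S = UNIV \<longleftrightarrow> S = {}" if "S \<subseteq> A" for S
      using that proper by auto
    have "(\<Sum>S\<in>Pow A. of_bool (\<Inter>S = UNIV) * (- 1) ^ card S) = (\<Sum>S\<in>Pow A. if S = {} then 1 else (0::int))"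
      by (intro sum.cong refl) (use * in auto)
    also have "\<dots> = 1"
      using fin by simp
    finally show ?thesis
      using True by (simp add: moebius.simps)
  next
    case False
    define Up where "Up = {Z\<in>flats A. L \<subset> Z}"
    define AL where "AL = {H\<in>A. L \<subseteq> H}"
    have finF: "finite (flats A)"
      by (rule finite_flats[OF fin])
    then have finUp: "finite Up"
      by (simp add: Up_def)
    have IH: "moebius (flats A) UNIV Z = f Z" if "Z \<in> Up" for Z
    proof -
      have "{W\<in>flats A. Z \<subset> W} \<subset> Up"
        using that by (auto simp: Up_def)
      then have "card {W\<in>flats A. Z \<subset> W} < card {Z\<in>flats A. L \<subset> Z}"
        using finUp unfolding Up_def by (intro psubset_card_mono)
      then show ?thesis
        using less.hyps[of Z] that unfolding f_def Up_def by blast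
    qed
    have "AL \<noteq> {}"
      using flat_eq_Inter[OF less.prems] False unfolding AL_def by auto
    have "(\<Sum>Z\<in>insert L Up. f Z) = (\<Sum>S\<in>Pow A. \<Sum>Z\<in>insert L Up. of_bool (\<Inter>S = Z) * (- 1) ^ card S)"
      unfolding f_def by (rule sum.swap)
    \<comment> \<open>each \<open>S\<close> contributes through the single flat that is its intersection\<close>
    also have "\<dots> = (\<Sum>S\<in>Pow A. if S \<in> Pow AL then (- 1) ^ card S else 0)"
    proof (intro sum.cong refl)
      fix S assume "S \<in> Pow A"
      then have "\<Inter>S \<in> insert L Up \<longleftrightarrow> S \<in> Pow AL"
        by (auto simp: Up_def AL_def flats_def)
      moreover have "(\<Sum>Z\<in>insert L Up. of_bool (\<Inter>S = Z) * (- 1) ^ card S)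
          = (\<Sum>Z\<in>insert L Up. if \<Inter>S = Z then (- 1) ^ card S else (0::int))"
        by (intro sum.cong refl) simp
      ultimately show "(\<Sum>Z\<in>insert L Up. of_bool (\<Inter>S = Z) * (- 1) ^ card S)
          = (if S \<in> Pow AL then (- 1) ^ card S else (0::int))"
        using finUp by (simp del: sum.insert)
    qed
    also have "\<dots> = (\<Sum>S\<in>Pow AL. (- 1) ^ card S)"
    proof -
      have "Pow A \<inter> Pow AL = Pow AL"
        by (auto simp: AL_def)
      then show ?thesis
        using fin by (simp only: sum.inter_restrict[symmetric] finite_Pow_iff)
    qed
    also have "\<dots> = 0"
      using fin \<open>AL \<noteq> {}\<close> by (intro sum_alternating_Pow) (auto simp: AL_def)
    finally have "f L = - (\<Sum>Z\<in>Up. f Z)"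
      using finUp by (simp add: Up_def)
    moreover have "moebius (flats A) UNIV L = - (\<Sum>Z\<in>Up. moebius (flats A) UNIV Z)"
      using False finF by (subst moebius.simps) (auto simp: Up_def)
    ultimately show ?thesis
      using IH unfolding f_def[symmetric] by simp
  qed
qed

lemma abs_moebius_flats:
  assumes A: "arrangement A" and L: "L \<in> flats A"
  shows "\<bar>moebius (flats A) UNIV L\<bar> = abs_moebius normal {H\<in>A. L \<subseteq> H} UNIV L"
proof -
  let ?AL = "{H\<in>A. L \<subseteq> H}"
  have fin: "finite A"
    using A by (simp add: arrangement_def)
  have proper: "UNIV \<notin> A"
  proof
    assume U: "UNIV \<in> A"
    then have "normal UNIV \<bullet> normal (UNIV :: 'a set) = 0"
      using normal_inner_eq_0_iff[OF A U] by blast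
    then show False
      using normal(1)[OF A U] by simp
  qed
  have "moebius (flats A) UNIV L = (\<Sum>S\<in>Pow A. of_bool (\<Inter>S = L) * (- 1) ^ card S)"
    by (rule moebius_flats_eq_alternating_sum[OF fin proper L])
  also have "\<dots> = (\<Sum>S\<in>Pow ?AL. of_bool (\<Inter>S = L) * (- 1) ^ card S)"
    using fin by (intro sum.mono_neutral_right) auto
  also have "\<dots> = signed_count normal ?AL UNIV L"
    unfolding signed_count_def
  proof (intro sum.cong refl)
    fix S assume "S \<in> Pow ?AL"
    then have "S \<subseteq> A"
      by blast
    then show "of_bool (\<Inter>S = L) * (- 1) ^ card S = (of_bool (UNIV \<inter> flat_of normal S = L) * (- 1) ^ card S :: int)"
      by (simp add: flat_of_normal[OF A])
  qed
  finally have *: "moebius (flats A) UNIV L = signed_count normal ?AL UNIV L" .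
  have "abs_moebius normal ?AL UNIV L \<ge> 0"
    using fin by (intro abs_moebius_nonneg) auto
  moreover have "\<bar>abs_moebius normal ?AL UNIV L\<bar> = \<bar>moebius (flats A) UNIV L\<bar>"
    by (simp add: * abs_moebius_def abs_mult power_abs)
  ultimately show ?thesis
    by simp
qed

lemma faces_of_dim_closed_cell:
  fixes a :: "'b \<Rightarrow> 'a::euclidean_space"
  assumes fin: "finite I"
  shows "faces_of_dim k (closed_cell a I y)
       = {F \<in> range (closed_cell a I). aff_dim F = int k \<and> F face_of closed_cell a I y}"
proof (intro equalityI subsetI)
  fix F assume "F \<in> faces_of_dim k (closed_cell a I y)"
  then show "F \<in> {F \<in> range (closed_cell a I). aff_dim F = int k \<and> F face_of closed_cell a I y}"
    using face_of_closed_cellE[OF fin] unfolding faces_of_dim_def by blast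
next
  fix F assume "F \<in> {F \<in> range (closed_cell a I). aff_dim F = int k \<and> F face_of closed_cell a I y}"
  then show "F \<in> faces_of_dim k (closed_cell a I y)"
    using self_in_closed_cell unfolding faces_of_dim_def by blast
qed

section \<open>Evaluation of the sums over faces\<close>

text \<open>Count pairs of a chamber \<open>C\<close> and a face \<open>F\<close> grouped by the span \<open>L\<close> of \<open>F\<close>. The condition on
  the pair splits into one on \<open>F\<close>, that the projection \<open>q L\<close> of \<open>x\<close> lies in \<open>F\<close>, and one on
  \<open>C\<close>, which for every \<open>F\<close> leaves the same number of chambers, computed in the localization
  at \<open>L\<close>.\<close>

lemma V_arr_eq_sum_over_flats:
  fixes A :: "'a::euclidean_space set set"
  assumes A: "arrangement A"
    and q: "\<And>L. L \<in> flats A \<Longrightarrow> q L \<in> L"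
    and orth: "\<And>L w. L \<in> flats A \<Longrightarrow> w \<in> L \<Longrightarrow> (x - q L) \<bullet> w = 0"
  shows "V_arr k A x = (\<Sum>L\<in>{L\<in>flats A. dim L = k}.
      int (card (cells_over normal A L (q L))) * int (card (sectors_below normal {H\<in>A. L \<subseteq> H} UNIV (x - q L))))"
proof -
  have fin: "finite A"
    using A by (simp add: arrangement_def)
  let ?cell = "closed_cell normal A"
  let ?N = "\<lambda>L. int (card (sectors_below normal {H\<in>A. L \<subseteq> H} UNIV (x - q L)))"
  define Fk where "Fk = {F \<in> range ?cell. aff_dim F = int k}"
  define Ch where "Ch = cone_chambers normal A"
  define Lk where "Lk = {L\<in>flats A. dim L = k}"
  define hit where "hit F C \<longleftrightarrow> F face_of C \<and> x \<in> face_normal_sum F C" for F C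
  have finFk: "finite Fk"
    by (rule finite_subset[OF _ finite_closed_cells[OF fin]]) (auto simp: Fk_def)
  have finCh: "finite Ch"
    by (rule finite_subset[OF _ finite_closed_cells[OF fin]]) (auto simp: Ch_def cone_chambers_def)
  have finLk: "finite Lk"
    using finite_flats[OF fin] by (simp add: Lk_def)
  have local: "(\<Sum>C\<in>Ch. of_bool (hit F C)) = of_bool (q (affine hull F) \<in> F) * ?N (affine hull F)"
    if FFk: "F \<in> Fk" for F
  proof -
    obtain p where F: "F = ?cell p"
      using FFk by (auto simp: Fk_def)
    define L where "L = affine hull F"
    have L: "L = flat_of normal (zeros normal A p)"
      unfolding L_def F by (rule affine_hull_closed_cell[OF fin])
    have Lfl: "L \<in> flats A"
      unfolding L by (rule flat_of_zeros_in_flats[OF A])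
    have Z: "zeros normal A p = {H\<in>A. L \<subseteq> H}"
      by (rule zeros_eq_containing[OF A L[symmetric]])
    have hit_iff: "hit F C \<longleftrightarrow> q L \<in> F \<and> p \<in> C \<and> (\<forall>z\<in>C. (x - q L) \<bullet> z \<le> 0)" if C: "C \<in> Ch" for C
    proof -
      obtain y where Cy: "C = ?cell y"
        using C by (auto simp: Ch_def cone_chambers_def)
      have face: "F face_of C \<longleftrightarrow> p \<in> C"
        using closed_cell_face_of self_in_closed_cell face_of_imp_subset unfolding F Cy by blast
      have "x \<in> face_normal_sum F C \<longleftrightarrow> q L \<in> F \<and> (\<forall>z\<in>C. (x - q L) \<bullet> z \<le> 0)" if "p \<in> C"
        using mem_face_normal_sum_iff[OF fin L that[unfolded Cy] q[OF Lfl] orth[OF Lfl]]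
        unfolding F Cy by simp
      then show ?thesis
        using face by (auto simp: hit_def)
    qed
    have "(\<Sum>C\<in>Ch. of_bool (hit F C)) = int (card {C\<in>Ch. hit F C})"
      using finCh by (simp add: Int_def)
    also have "\<dots> = of_bool (q L \<in> F) * int (card {C\<in>Ch. p \<in> C \<and> (\<forall>z\<in>C. (x - q L) \<bullet> z \<le> 0)})"
    proof (cases "q L \<in> F")
      case True
      then have "{C\<in>Ch. hit F C} = {C\<in>Ch. p \<in> C \<and> (\<forall>z\<in>C. (x - q L) \<bullet> z \<le> 0)}"
        using hit_iff by blast
      with True show ?thesis by simp
    next
      case False
      then have "{C\<in>Ch. hit F C} = {}"
        using hit_iff by blast
      with False show ?thesis by (simp del: Collect_empty_eq)
    qed
    also have "card {C\<in>Ch. p \<in> C \<and> (\<forall>z\<in>C. (x - q L) \<bullet> z \<le> 0)}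
        = card (sectors_below normal {H\<in>A. L \<subseteq> H} UNIV (x - q L))"
      unfolding Ch_def Z[symmetric] using orth[OF Lfl] unfolding L by (intro card_chambers_below[OF fin])
    finally show ?thesis
      unfolding L_def .
  qed
  have "V_arr k A x = (\<Sum>C\<in>Ch. \<Sum>F\<in>Fk. of_bool (hit F C))"
    unfolding V_arr_def chambers_eq_cone_chambers[OF A] Ch_def[symmetric] V_cone_def
  proof (rule sum.cong[OF refl])
    fix C assume "C \<in> Ch"
    then have "faces_of_dim k C = {F\<in>Fk. F face_of C}"
      unfolding Ch_def cone_chambers_def Fk_def using faces_of_dim_closed_cell[OF fin] by auto
    then have "(\<Sum>F\<in>faces_of_dim k C. indicator (face_normal_sum F C) x)
        = (\<Sum>F\<in>Fk. if F face_of C then indicator (face_normal_sum F C) x else (0::int))"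
      using finFk by (simp add: sum.inter_filter)
    also have "\<dots> = (\<Sum>F\<in>Fk. of_bool (hit F C))"
      by (intro sum.cong refl) (auto simp: hit_def indicator_def)
    finally show "(\<Sum>F\<in>faces_of_dim k C. indicator (face_normal_sum F C) x) = (\<Sum>F\<in>Fk. of_bool (hit F C) :: int)" .
  qed
  also have "\<dots> = (\<Sum>F\<in>Fk. \<Sum>C\<in>Ch. of_bool (hit F C))"
    by (rule sum.swap)
  also have "\<dots> = (\<Sum>F\<in>Fk. of_bool (q (affine hull F) \<in> F) * ?N (affine hull F))"
    using local by (intro sum.cong refl)
  also have "\<dots> = (\<Sum>L\<in>Lk. \<Sum>F\<in>{F\<in>Fk. affine hull F = L}. of_bool (q (affine hull F) \<in> F) * ?N (affine hull F))"
  proof (intro sum.group[symmetric] finFk finLk)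
    show "(\<lambda>F. affine hull F) ` Fk \<subseteq> Lk"
    proof (clarify, goal_cases)
      case (1 _ F)
      then obtain p where "F = ?cell p" "aff_dim F = int k"
        by (auto simp: Fk_def)
      then show ?case
        using aff_dim_closed_cell[OF fin, of normal p] affine_hull_closed_cell[OF fin, of normal p]
          flat_of_zeros_in_flats[OF A, of p] by (simp add: Lk_def)
    qed
  qed
  also have "\<dots> = (\<Sum>L\<in>Lk. int (card (cells_over normal A L (q L))) * ?N L)"
  proof (intro sum.cong refl)
    fix L assume L: "L \<in> Lk"
    let ?FL = "{F\<in>Fk. affine hull F = L}"
    have "(\<Sum>F\<in>?FL. of_bool (q (affine hull F) \<in> F) * ?N (affine hull F)) = (\<Sum>F\<in>?FL. of_bool (q L \<in> F) * ?N L)"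
      by (intro sum.cong refl) auto
    also have "\<dots> = (\<Sum>F\<in>?FL. of_bool (q L \<in> F)) * ?N L"
      by (simp only: sum_distrib_right)
    also have "(\<Sum>F\<in>?FL. of_bool (q L \<in> F)) = int (card (?FL \<inter> {F. q L \<in> F}))"
      using finFk by simp
    also have "?FL \<inter> {F. q L \<in> F} = cells_over normal A L (q L)"
    proof -
      have "aff_dim (?cell p) = int k" if "flat_of normal (zeros normal A p) = L" for p
        using aff_dim_closed_cell[OF fin, of normal p] that L by (simp add: Lk_def)
      then show ?thesis
        unfolding cells_over_def Fk_def using affine_hull_closed_cell[OF fin, of normal] by auto
    qed
    finally show "(\<Sum>F\<in>?FL. of_bool (q (affine hull F) \<in> F) * ?N (affine hull F))
        = int (card (cells_over normal A L (q L))) * ?N L" .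
  qed
  finally show ?thesis
    unfolding Lk_def .
qed

lemma orthogonal_projection_unique:
  fixes x :: "'a::euclidean_space"
  assumes "subspace M" "q \<in> M" "q' \<in> M"
    and "\<And>w. w \<in> M \<Longrightarrow> (x - q) \<bullet> w = 0" "\<And>w. w \<in> M \<Longrightarrow> (x - q') \<bullet> w = 0"
  shows "q = q'"
proof -
  have "q - q' \<in> M"
    using assms by (simp add: subspace_diff)
  then have "(x - q') \<bullet> (q - q') - (x - q) \<bullet> (q - q') = 0"
    using assms(4,5) by simp
  then have "(q - q') \<bullet> (q - q') = 0"
    by (simp add: inner_diff_left algebra_simps)
  then show ?thesis
    by simp
qed

text \<open>Membership in \<open>(H \<inter> L) + L\<^sup>\<bottom>\<close> only depends on the orthogonal projection to \<open>L\<close>.\<close>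

lemma mem_Pi_arr_iff:
  fixes A :: "'a::euclidean_space set set"
  assumes A: "arrangement A"
    and q: "\<And>L. L \<in> flats A \<Longrightarrow> q L \<in> L"
    and orth: "\<And>L w. L \<in> flats A \<Longrightarrow> w \<in> L \<Longrightarrow> (x - q L) \<bullet> w = 0"
  shows "(\<exists>K\<in>Pi_arr A. x \<in> K) \<longleftrightarrow> (\<exists>L\<in>flats A. \<exists>H\<in>A. \<not> L \<subseteq> H \<and> q L \<in> H)"
proof -
  have "x \<in> (H \<inter> L) + L\<^sup>\<bottom> \<longleftrightarrow> q L \<in> H" if L: "L \<in> flats A" for H L
  proof
    assume "x \<in> (H \<inter> L) + L\<^sup>\<bottom>"
    then obtain h v where x: "x = h + v" "h \<in> H" "h \<in> L" "v \<in> L\<^sup>\<bottom>"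
      by (auto simp: set_plus_def)
    have "(x - h) \<bullet> w = 0" if "w \<in> L" for w
      using x that by (simp add: orthogonal_comp_def orthogonal_def inner_commute[of v])
    then have "q L = h"
      using orthogonal_projection_unique[OF subspace_flat[OF A L] q[OF L] x(3) orth[OF L]] by blast
    with x show "q L \<in> H" by simp
  next
    assume "q L \<in> H"
    moreover have "x - q L \<in> L\<^sup>\<bottom>"
      using orth[OF L] by (simp add: orthogonal_comp_def orthogonal_def inner_commute)
    ultimately have "q L + (x - q L) \<in> (H \<inter> L) + L\<^sup>\<bottom>"
      using q[OF L] by (intro set_plus_intro) auto
    then show "x \<in> (H \<inter> L) + L\<^sup>\<bottom>"
      by simp
  qed
  then show ?thesis
    unfolding Pi_arr_def lift_arrangement_def restriction_def by blast
qed

theorem corollary3p9: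
  fixes A :: "'a::euclidean_space set set" and x :: 'a
  assumes "arrangement A"
  shows "(\<exists>k::nat. k \<le> DIM('a) \<and> V_arr k A x > whitney k A) \<longleftrightarrow> (\<exists>H\<in>Pi_arr A. x \<in> H)"
proof -
  note A = assms
  have fin: "finite A"
    using A by (simp add: arrangement_def)
  have "\<exists>q. subspace L \<longrightarrow> q \<in> L \<and> (\<forall>w\<in>L. (x - q) \<bullet> w = 0)" for L
  proof -
    obtain y z where "y \<in> span L" "\<And>w. w \<in> span L \<Longrightarrow> orthogonal z w" "x = y + z"
      by (rule orthogonal_subspace_decomp_exists[of L x]) blast
    then have "y \<in> span L \<and> (\<forall>w\<in>span L. (x - y) \<bullet> w = 0)"
      by (auto simp: orthogonal_def)
    then show ?thesis
      by (metis span_eq_iff)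
  qed
  then obtain q where "\<And>L. subspace L \<longrightarrow> q L \<in> L \<and> (\<forall>w\<in>L. (x - q L) \<bullet> w = 0)"
    by metis
  then have q: "q L \<in> L" and orth: "w \<in> L \<Longrightarrow> (x - q L) \<bullet> w = 0" if "L \<in> flats A" for L w
    using subspace_flat[OF A that] by auto
  define m where "m L = int (card (cells_over normal A L (q L)))" for L
  define n where "n L = int (card (sectors_below normal {H\<in>A. L \<subseteq> H} UNIV (x - q L)))" for L
  define \<mu> where "\<mu> L = abs_moebius normal {H\<in>A. L \<subseteq> H} UNIV L" for L
  have V: "V_arr k A x = (\<Sum>L\<in>{L\<in>flats A. dim L = k}. m L * n L)" for k
    unfolding m_def n_def using A q orth by (rule V_arr_eq_sum_over_flats)
  have w: "whitney k A = (\<Sum>L\<in>{L\<in>flats A. dim L = k}. \<mu> L)" for k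
    unfolding whitney_def \<mu>_def by (intro sum.cong refl abs_moebius_flats[OF A]) simp
  have finF: "finite {L\<in>flats A. dim L = k}" for k
    using finite_flats[OF fin] by simp
  have Pi: "(\<exists>K\<in>Pi_arr A. x \<in> K) \<longleftrightarrow> (\<exists>L\<in>flats A. \<exists>H\<in>A. \<not> L \<subseteq> H \<and> q L \<in> H)"
    using A q orth by (rule mem_Pi_arr_iff)
  have sub_iff: "L \<subseteq> flat_of normal {H} \<longleftrightarrow> L \<subseteq> H" if "H \<in> A" for H L
    using normal(2)[OF A that] by simp
  have L_eq: "L = flat_of normal {H\<in>A. L \<subseteq> flat_of normal {H}}" if "L \<in> flats A" for L
  proof -
    have "{H\<in>A. L \<subseteq> flat_of normal {H}} = {H\<in>A. L \<subseteq> H}"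
      using sub_iff by blast
    then show ?thesis
      using flat_eq_Inter[OF that] flat_of_normal[OF A, of "{H\<in>A. L \<subseteq> H}"] by simp
  qed
  have m1: "m L \<ge> 1" if "L \<in> flats A" for L
    unfolding m_def using card_cells_over_ge_1[OF fin L_eq[OF that] q[OF that]] by simp
  have \<mu>1: "\<mu> L \<ge> 1" if L: "L \<in> flats A" for L
  proof -
    have "\<not> UNIV \<subseteq> flat_of normal {H}" if H: "H \<in> {H\<in>A. L \<subseteq> H}" for H
    proof
      assume "UNIV \<subseteq> flat_of normal {H}"
      then have "normal H \<bullet> normal H = 0"
        by (simp add: flat_of_def subset_iff)
      with normal(1)[OF A] H show False by auto
    qed
    moreover have "UNIV \<inter> flat_of normal {H\<in>A. L \<subseteq> H} = L"
      using flat_eq_Inter[OF L] flat_of_normal[OF A, of "{H\<in>A. L \<subseteq> H}"] by simp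
    ultimately have "abs_moebius normal {H\<in>A. L \<subseteq> H} UNIV L > 0"
      using fin by (intro abs_moebius_pos) auto
    then show ?thesis
      by (simp add: \<mu>_def)
  qed
  have n\<mu>: "n L \<ge> \<mu> L" if "L \<in> flats A" for L
    unfolding n_def \<mu>_def using fin orth[OF that] by (intro abs_moebius_le_card_sectors_below) auto
  have le: "\<mu> L \<le> m L * n L" if "L \<in> flats A" for L
  proof -
    have "1 * n L \<le> m L * n L"
      using m1[OF that] \<mu>1[OF that] n\<mu>[OF that] by (intro mult_right_mono) auto
    then show ?thesis
      using n\<mu>[OF that] by simp
  qed
  show ?thesis
  proof
    assume "\<exists>H\<in>Pi_arr A. x \<in> H"
    then obtain L H where LH: "L \<in> flats A" "H \<in> A" "\<not> L \<subseteq> H" "q L \<in> H"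
      using Pi by blast
    have "m L \<ge> 2"
      unfolding m_def
      using card_cells_over_ge_2[OF fin L_eq[OF LH(1)] q[OF LH(1)] LH(2)] LH sub_iff normal_inner_eq_0_iff[OF A LH(2)] by simp
    then have "2 * n L \<le> m L * n L"
      using \<mu>1[OF LH(1)] n\<mu>[OF LH(1)] by (intro mult_right_mono) auto
    then have "\<mu> L < m L * n L"
      using \<mu>1[OF LH(1)] n\<mu>[OF LH(1)] by linarith
    then have "whitney (dim L) A < V_arr (dim L) A x"
      unfolding V w using LH(1) le finF by (intro sum_strict_mono_ex1) auto
    moreover have "dim L \<le> DIM('a)"
      by (rule dim_subset_UNIV)
    ultimately show "\<exists>k\<le>DIM('a). V_arr k A x > whitney k A"
      by blast
  next
    assume "\<exists>k\<le>DIM('a). V_arr k A x > whitney k A"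
    then obtain k where k: "V_arr k A x > whitney k A"
      by blast
    show "\<exists>H\<in>Pi_arr A. x \<in> H"
    proof (rule ccontr)
      assume "\<not> ?thesis"
      then have generic: "q L \<notin> H" if "L \<in> flats A" "H \<in> A" "\<not> L \<subseteq> H" for L H
        using that Pi by blast
      have "m L * n L = \<mu> L" if L: "L \<in> flats A" for L
      proof -
        have "m L = 1"
          unfolding m_def
          using card_cells_over_eq_1[OF fin L_eq[OF L] q[OF L]] generic[OF L] sub_iff normal_inner_eq_0_iff[OF A] by auto
        moreover have "n L = \<mu> L"
          unfolding n_def \<mu>_def
        proof (rule card_sectors_below_eq_abs_moebius)
          fix S assume S: "S \<subseteq> {H\<in>A. L \<subseteq> H}"
          define M where "M = \<Inter>S"
          have "S \<subseteq> A"
            using S by blast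
          then have MS: "UNIV \<inter> flat_of normal S = M" and M: "M \<in> flats A"
            using flat_of_normal[OF A, of S] by (auto simp: M_def flats_def)
          have LM: "L \<subseteq> M"
            using S by (auto simp: M_def)
          have "M = L" if perp: "\<forall>y\<in>M. (x - q L) \<bullet> y = 0"
          proof (rule ccontr)
            assume "M \<noteq> L"
            then obtain H where H: "H \<in> A" "L \<subseteq> H" "\<not> M \<subseteq> H"
              using LM flat_eq_Inter[OF L] by blast
            \<comment> \<open>\<open>q L\<close> lies in \<open>M\<close> and \<open>x - q L\<close> is orthogonal to \<open>M\<close>; so the projection to \<open>M\<close> lies on the hyperplane \<open>H \<inter> M\<close> of the restriction to \<open>M\<close>\<close>
            have "q M = q L"
              using orthogonal_projection_unique[OF subspace_flat[OF A M] q[OF M] _ orth[OF M]] perp q[OF L] LM by blast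
            then show False
              using generic[OF M H(1,3)] q[OF L] H(2) by auto
          qed
          then show "(\<forall>y\<in>UNIV \<inter> flat_of normal S. (x - q L) \<bullet> y = 0) \<longleftrightarrow> UNIV \<inter> flat_of normal S = L"
            unfolding MS using orth[OF L] by blast
        qed (use fin in auto)
        ultimately show ?thesis by simp
      qed
      then have "V_arr k A x = whitney k A"
        unfolding V w by (intro sum.cong) auto
      with k show False by simp
    qed
  qed
qed

end
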